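(* Let $\alpha>0$, let $f:\mathbb{C}\to[0,\infty)$ be given by $f(z)=e^{-\gamma|z|^2}$ with $\gamma>2\alpha$, and let $\Lambda\subseteq\mathbb{C}$ be a Liouville set for $\mathcal{F}_{4\alpha}(\mathbb{C})$ of finite density. If $$Z_{\lambda,\ell},\quad(\lambda,\ell)\in\Lambda\times\{1,2,3\},$$ is a sequence of independent complex random variables, where each $Z_{\lambda,\ell}$ is uniformly distributed on the disk $B_{f(\lambda)}(\lambda)$, then $\mathcal{U}=\{Z_{\lambda,\ell}:(\lambda,\ell)\in\Lambda\times\{1,2,3\}\}$ is a uniqueness set for the phase retrieval problem in $\mathcal{F}_\alpha(\mathbb{C})$ almost surely.
   Context: For $\alpha>0$, $\mathcal{F}_\alpha(\mathbb{C})$ is the Fock space of entire functions $F:\mathbb{C}\to\mathbb{C}$ with $\int_{\mathbb{C}}|F(z)|^2e^{-\alpha|z|^2}\,dA(z)<\infty$, where $dA$ is Lebesgue area measure. $B_r(z)=\{w\in\mathbb{C}:|w-z|\le r\}$ is the closed ball. A set $\Lambda\subseteq\mathbb{C}$ is a Liouville set for a set $V$ of entire functions if every $F\in V$ that is bounded on $\Lambda$ is a constant function. A set $\Lambda\subseteq\mathbb{C}$ has finite density if $\sup_{z\in\mathbb{C}}\#(\Lambda\cap B_1(z))<\infty$. A set $\mathcal{U}\subseteq\mathbb{C}$ is a uniqueness set for the phase retrieval problem in $\mathcal{F}_\alpha(\mathbb{C})$ if for all $F,H\in\mathcal{F}_\alpha(\mathbb{C})$: whenever $|F(u)|=|H(u)|$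 for all $u\in\mathcal{U}$, there is $\tau\in\mathbb{C}$ with $|\tau|=1$ and $H=\tau F$. *)

theory Defs
  imports "HOL-Probability.Probability" "HOL-Complex_Analysis.Complex_Analysis"
begin

definition fock_space :: "real \<Rightarrow> (complex \<Rightarrow> complex) set" where
  "fock_space \<alpha> = {F. F holomorphic_on UNIV \<and>
     integrable lborel (\<lambda>z. (cmod (F z))\<^sup>2 * exp (- \<alpha> * (cmod z)\<^sup>2))}"

definition liouville_set :: "(complex \<Rightarrow> complex) set \<Rightarrow> complex set \<Rightarrow> bool" where
  "liouville_set V \<Lambda> \<longleftrightarrow> (\<forall>F\<in>V. bounded (F ` \<Lambda>) \<longrightarrow> F constant_on UNIV)"

text \<open>Since \<open>card\<close> is \<open>0\<close> on infinite sets, finiteness of the supremum needs the explicit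
  finiteness of every intersection.\<close>

definition finite_density :: "complex set \<Rightarrow> bool" where
  "finite_density \<Lambda> \<longleftrightarrow> (\<forall>z. finite (\<Lambda> \<inter> cball z 1)) \<and>
     bdd_above (range (\<lambda>z. card (\<Lambda> \<inter> cball z 1)))"

definition phase_retrieval_uniqueness_set :: "(complex \<Rightarrow> complex) set \<Rightarrow> complex set \<Rightarrow> bool" where
  "phase_retrieval_uniqueness_set V U \<longleftrightarrow>
     (\<forall>F\<in>V. \<forall>H\<in>V. (\<forall>u\<in>U. cmod (F u) = cmod (H u)) \<longrightarrow>
        (\<exists>\<tau>. cmod \<tau> = 1 \<and> H = (\<lambda>z. \<tau> * F z)))"

end

theory Submission
  imports Defs "HOL-Real_Asymp.Real_Asymp"
begin

text \<open>
  Let \<open>F\<close> and \<open>H\<close> have equal modulus on the random set. The proof reduces the claim to a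
  holomorphic function to which the Liouville property applies, namely \<open>F W\<close> with the
  Wronskian \<open>W = F' H - F H'\<close>. If \<open>F W\<close> vanishes identically, then \<open>H\<close> is a multiple of \<open>F\<close>
  (\<open>proportional_if_wronskian_zero\<close>), and the multiple is unimodular as soon as \<open>F\<close> does not
  vanish on the whole random set.

  The size of \<open>F W\<close> at a point \<open>l\<close> is controlled by the real-analytic function
  \<open>g = |F|^2 - |H|^2\<close>: with \<open>P = F' cnj F - H' cnj H\<close>, which is the complex derivative of \<open>g\<close>,
  one has \<open>cnj F * W = H * P - H' * g\<close>. Now \<open>g\<close> vanishes at three points in the disk of radius
  \<open>r = exp (- \<gamma> |l|^2)\<close> about \<open>l\<close>, and up to a quadratic error it is affine there. An affine
  function on the plane is determined by its values at the vertices of a triangle, with a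
  constant that depends, up to scaling, only on how degenerate the triangle is. Hence \<open>P\<close> and \<open>g\<close> are small at
  \<open>l\<close> when the triangle of the three random points has area at least \<open>\<epsilon> r^2 / 2\<close>
  (\<open>three_point_estimate\<close>).

  A function in the Fock space grows, together with its derivatives, at most like
  \<open>exp (b |z|^2)\<close> for each \<open>b > \<alpha> / 2\<close>. For \<open>b = 5 \<alpha> / 8\<close> and
  \<open>\<epsilon> = exp (- \<alpha> |l|^2 / 8)\<close>, the three-point bound on \<open>F W\<close> at \<open>l\<close> is of the order of
  \<open>exp (3 b |l|^2) r / \<epsilon> = exp (- (\<gamma> - 2 \<alpha>) |l|^2)\<close>, which is so small that even
  \<open>l F(l) W(l)\<close> stays bounded on \<open>\<Lambda>\<close>. The function \<open>z F W\<close> belongs to the Fock space with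
  parameter \<open>4 \<alpha>\<close>, so it is constant; the factor \<open>z\<close> makes it vanish at the origin, so it is zero.
  The same argument with \<open>F^2\<close> in place of \<open>F W\<close> shows that a function of the Fock space that
  vanishes on the random set is zero.

  All this needs a nondegenerate triangle only at all but finitely many \<open>l\<close>, because finitely
  many values never spoil boundedness. A random triangle is \<open>\<epsilon>\<close>-degenerate with probability
  at most of the order of \<open>sqrt \<epsilon>\<close> (\<open>prob_thin_triangle_le\<close>), and the number of points of \<open>\<Lambda>\<close>
  in the disk of radius \<open>n\<close> grows at most quadratically, so the Borel--Cantelli lemma applies
  (\<open>AE_eventually_not_bad\<close>).
\<close>

section \<open>Lebesgue measure on the complex plane\<close>

lemma measurable_Complex [measurable]:
  "(\<lambda>p. Complex (fst p) (snd p)) \<in> borel \<Otimes>\<^sub>M borel \<rightarrow>\<^sub>M borel"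
  unfolding borel_prod by (intro borel_measurable_continuous_onI continuous_intros)

text \<open>
  Iterated integration over real and imaginary parts rests on this identification: the type
  \<open>complex\<close> is not a product type, so the product measure has to be transported.
\<close>
lemma lborel_complex_eq:
  "(lborel :: complex measure) = distr (lborel \<Otimes>\<^sub>M lborel) borel (\<lambda>(x, y). Complex x y)"
proof (rule lborel_eqI)
  have meas: "(\<lambda>(x, y). Complex x y) \<in> lborel \<Otimes>\<^sub>M lborel \<rightarrow>\<^sub>M borel"
    using measurable_Complex by (simp add: case_prod_beta lborel_prod borel_prod)
  fix l u :: complex
  assume le: "\<And>b. b \<in> Basis \<Longrightarrow> l \<bullet> b \<le> u \<bullet> b"
  have "(\<lambda>(x, y). Complex x y) -` box l u = {Re l<..<Re u} \<times> {Im l<..<Im u}"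
    by (auto simp: in_box_complex_iff)
  moreover have "Re l \<le> Re u" "Im l \<le> Im u"
    using le[of 1] le[of \<i>] by (auto simp: Basis_complex_def)
  ultimately show "emeasure (distr (lborel \<Otimes>\<^sub>M lborel) borel (\<lambda>(x, y). Complex x y)) (box l u)
      = (\<Prod>b\<in>Basis. (u - l) \<bullet> b)"
    using meas
    by (subst emeasure_distr) (auto simp: space_pair_measure lborel.emeasure_pair_measure_Times
         Basis_complex_def ennreal_mult)
qed simp

lemma nn_integral_complex:
  assumes [measurable]: "f \<in> borel_measurable borel"
  shows "(\<integral>\<^sup>+z. f z \<partial>(lborel :: complex measure)) = (\<integral>\<^sup>+x. \<integral>\<^sup>+y. f (Complex x y) \<partial>lborel \<partial>lborel)"
    and "(\<integral>\<^sup>+z. f z \<partial>(lborel :: complex measure)) = (\<integral>\<^sup>+y. \<integral>\<^sup>+x. f (Complex x y) \<partial>lborel \<partial>lborel)"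
proof -
  have m: "(\<lambda>(x, y). Complex x y) \<in> lborel \<Otimes>\<^sub>M lborel \<rightarrow>\<^sub>M borel"
    using measurable_Complex by (simp add: case_prod_beta lborel_prod borel_prod)
  have m2: "(\<lambda>p. f (Complex (fst p) (snd p))) \<in> borel_measurable (lborel \<Otimes>\<^sub>M lborel)"
    using m by (simp add: case_prod_beta)
  have "(\<integral>\<^sup>+z. f z \<partial>(lborel :: complex measure))
      = (\<integral>\<^sup>+p. f (Complex (fst p) (snd p)) \<partial>(lborel \<Otimes>\<^sub>M lborel))"
    using m by (subst lborel_complex_eq) (simp add: nn_integral_distr case_prod_beta)
  then show "(\<integral>\<^sup>+z. f z \<partial>(lborel :: complex measure)) = (\<integral>\<^sup>+x. \<integral>\<^sup>+y. f (Complex x y) \<partial>lborel \<partial>lborel)"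
    and "(\<integral>\<^sup>+z. f z \<partial>(lborel :: complex measure)) = (\<integral>\<^sup>+y. \<integral>\<^sup>+x. f (Complex x y) \<partial>lborel \<partial>lborel)"
    using lborel.nn_integral_fst[OF m2] lborel_pair.nn_integral_snd[of "\<lambda>p. f (Complex (fst p) (snd p))"] m2
    by (simp_all add: case_prod_beta)
qed

text \<open>
  On each horizontal (vertical) line a shear is a translation, so the inner integral of an
  iterated integral does not change.
\<close>
lemma nn_integral_shear:
  fixes f :: "complex \<Rightarrow> ennreal" and t :: real
  assumes [measurable]: "f \<in> borel_measurable borel"
  shows nn_integral_shear_Re: "(\<integral>\<^sup>+z. f (z + of_real (t * Im z)) \<partial>lborel) = (\<integral>\<^sup>+z. f z \<partial>lborel)"
    and nn_integral_shear_Im: "(\<integral>\<^sup>+z. f (z + \<i> * of_real (t * Re z)) \<partial>lborel) = (\<integral>\<^sup>+z. f z \<partial>lborel)"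
proof -
  have trans: "(\<integral>\<^sup>+x. g (c + x) \<partial>lborel) = (\<integral>\<^sup>+x. g x \<partial>lborel)"
    if [measurable]: "g \<in> borel_measurable borel" for g :: "real \<Rightarrow> ennreal" and c
    by (subst (2) lborel_distr_plus[of c, symmetric]) (simp add: nn_integral_distr)
  have "Complex x y + of_real (t * y) = Complex (t * y + x) y"
       "Complex x y + \<i> * of_real (t * x) = Complex x (t * x + y)" for x y
    by (auto simp: complex_eq_iff)
  moreover have slice: "(\<lambda>x. f (Complex x y)) \<in> borel_measurable borel"
      "(\<lambda>y. f (Complex x y)) \<in> borel_measurable borel" for x y
    by (intro measurable_compose[OF borel_measurable_continuous_onI assms] continuous_intros)+
  ultimately show "(\<integral>\<^sup>+z. f (z + of_real (t * Im z)) \<partial>lborel) = (\<integral>\<^sup>+z. f z \<partial>lborel)"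
    and "(\<integral>\<^sup>+z. f (z + \<i> * of_real (t * Re z)) \<partial>lborel) = (\<integral>\<^sup>+z. f z \<partial>lborel)"
    using trans[OF slice(1), of "t * y" y for y] trans[OF slice(2), of x "t * x" for x]
    by (simp_all add: nn_integral_complex(2)[of "\<lambda>z. f (z + of_real (t * Im z))"]
        nn_integral_complex(1)[of "\<lambda>z. f (z + \<i> * of_real (t * Re z))"] del: of_real_mult)
      (simp_all add: nn_integral_complex(1)[symmetric] nn_integral_complex(2)[symmetric])
qed

text \<open>
  Every rotation other than the one by \<open>\<pi>\<close> is a product of a horizontal, a vertical and a
  horizontal shear; the rotation by \<open>\<pi>\<close> is a scaling by \<open>-1\<close>.
\<close>
lemma nn_integral_rotate:
  fixes f :: "complex \<Rightarrow> ennreal"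
  assumes [measurable]: "f \<in> borel_measurable borel" and u: "cmod u = 1"
  shows "(\<integral>\<^sup>+z. f (u * z) \<partial>lborel) = (\<integral>\<^sup>+z. f z \<partial>lborel)"
proof (cases "u = -1")
  case True
  have "distr lborel borel (uminus :: complex \<Rightarrow> complex) = lborel"
    using lborel_affine[of "-1" "0::complex"] by (simp add: density_1 Basis_complex_def)
  then have "(\<integral>\<^sup>+z. f z \<partial>lborel) = (\<integral>\<^sup>+z. f z \<partial>(distr lborel borel (uminus :: complex \<Rightarrow> complex)))"
    by simp
  also have "\<dots> = (\<integral>\<^sup>+z. f (- z) \<partial>lborel)"
    by (simp add: nn_integral_distr)
  finally show ?thesis using True by simp
next
  case False
  have unit: "(Re u)\<^sup>2 + (Im u)\<^sup>2 = 1"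
    using u by (simp add: cmod_def)
  have ne: "1 + Re u \<noteq> 0"
  proof
    assume "1 + Re u = 0"
    then have "Re u = -1" by simp
    with unit have "Im u = 0" by simp
    with \<open>Re u = -1\<close> False show False by (simp add: complex_eq_iff)
  qed
  \<comment> \<open>For \<open>u = exp (\<i> \<theta>)\<close> this is \<open>t = - tan (\<theta> / 2)\<close> and \<open>s = sin \<theta>\<close>.\<close>
  define t where "t = - Im u / (1 + Re u)"
  define s where "s = Im u"
  have c: "1 + t * s = Re u"
  proof -
    have "(Im u)\<^sup>2 = (1 + Re u) * (1 - Re u)"
      using unit by (simp add: algebra_simps power2_eq_square)
    then have "t * s = - (1 - Re u)"
      using ne by (simp add: t_def s_def field_simps power2_eq_square)
    then show ?thesis by simp
  qed
  have t2: "t * (1 + Re u) = - Im u"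
    using ne by (simp add: t_def)
  define A where "A = (\<lambda>z. z + of_real (t * Im z) :: complex)"
  define B where "B = (\<lambda>z. z + \<i> * of_real (s * Re z) :: complex)"
  have rot: "A (B (A z)) = u * z" for z
  proof -
    have "Re (A (B (A z))) = (1 + t * s) * Re z + (t * (1 + (1 + t * s))) * Im z"
         "Im (A (B (A z))) = s * Re z + (1 + t * s) * Im z"
      by (auto simp: A_def B_def algebra_simps)
    then show ?thesis
      unfolding c t2 by (simp add: s_def complex_eq_iff algebra_simps)
  qed
  have [measurable]: "A \<in> borel_measurable borel" "B \<in> borel_measurable borel"
    unfolding A_def B_def by measurable
  have "(\<integral>\<^sup>+z. f (u * z) \<partial>lborel) = (\<integral>\<^sup>+z. f (A (B (A z))) \<partial>lborel)"
    by (simp add: rot)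
  also have "\<dots> = (\<integral>\<^sup>+z. f (A (B z)) \<partial>lborel)"
    using nn_integral_shear_Re[of "\<lambda>z. f (A (B z))" t] by (simp add: A_def)
  also have "\<dots> = (\<integral>\<^sup>+z. f (A z) \<partial>lborel)"
    using nn_integral_shear_Im[of "\<lambda>z. f (A z)" s] by (simp add: B_def)
  also have "\<dots> = (\<integral>\<^sup>+z. f z \<partial>lborel)"
    using nn_integral_shear_Re[of f t] by (simp add: A_def)
  finally show ?thesis .
qed

lemma integrable_gaussian_complex:
  assumes c: "c > (0::real)"
  shows "integrable lborel (\<lambda>z::complex. exp (- c * (cmod z)\<^sup>2))"
proof (rule integrableI_nonneg)
  \<comment> \<open>The real Gaussian is, up to a constant, the normal density of this standard deviation.\<close>
  define \<sigma> where "\<sigma> = 1 / sqrt (2 * c)"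
  define k where "k = sqrt (2 * pi * \<sigma>\<^sup>2)"
  have \<sigma>: "\<sigma> > 0" using c by (simp add: \<sigma>_def)
  have s2: "2 * \<sigma>\<^sup>2 = 1 / c" using c by (simp add: \<sigma>_def power_divide)
  have k: "k > 0" using \<sigma> by (simp add: k_def)
  have eq: "exp (- c * x\<^sup>2) = k * normal_density 0 \<sigma> x" for x
    using k by (simp add: normal_density_def s2 k_def[symmetric])
  have one: "(\<integral>\<^sup>+x. ennreal (exp (- c * x\<^sup>2)) \<partial>lborel) < \<infinity>"
  proof -
    have "integrable lborel (\<lambda>x. exp (- c * x\<^sup>2))"
      unfolding eq using \<sigma> by (intro integrable_mult_right integrable_normal_density)
    then show ?thesis
      by (subst nn_integral_eq_integral) auto
  qed
  have "(\<integral>\<^sup>+z. ennreal (exp (- c * (cmod z)\<^sup>2)) \<partial>(lborel :: complex measure))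
      = (\<integral>\<^sup>+x. \<integral>\<^sup>+y. ennreal (exp (- c * x\<^sup>2)) * ennreal (exp (- c * y\<^sup>2)) \<partial>lborel \<partial>lborel)"
    by (subst nn_integral_complex(1))
       (simp_all add: cmod_def ennreal_mult'[symmetric] exp_add[symmetric] algebra_simps)
  also have "\<dots> = (\<integral>\<^sup>+x. ennreal (exp (- c * x\<^sup>2)) \<partial>lborel) * (\<integral>\<^sup>+y. ennreal (exp (- c * y\<^sup>2)) \<partial>lborel)"
    by (simp add: nn_integral_cmult nn_integral_multc)
  also have "\<dots> < \<infinity>"
    using one by (simp add: ennreal_mult_less_top)
  finally show "(\<integral>\<^sup>+z. ennreal (exp (- c * (cmod z)\<^sup>2)) \<partial>(lborel :: complex measure)) < \<infinity>" .
qed auto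

text \<open>
  The set is the part inside a disk of the strip of half-width \<open>h / |u|\<close> about the line
  \<open>Im (u (z - c)) = 0\<close>. After a rotation by \<open>u / |u|\<close> the line is horizontal, and the set lies in
  a box with sides \<open>2 r\<close> and \<open>2 h / |u|\<close>.
\<close>
lemma emeasure_strip_le:
  fixes u a c :: complex
  assumes u: "u \<noteq> 0" and r: "r \<ge> 0" and h: "h \<ge> 0"
  shows "emeasure lborel {z \<in> cball a r. \<bar>Im (u * (z - c))\<bar> \<le> h}
     \<le> ennreal (4 * r * h / cmod u)"
proof -
  define e where "e = sgn u"
  have e: "cmod e = 1" using u by (simp add: e_def norm_sgn)
  define k where "k = Im (u * c) / cmod u"
  define R where "R = cbox (Complex (Re (e * a) - r) (k - h / cmod u)) (Complex (Re (e * a) + r) (k + h / cmod u))"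
  have ue: "u = of_real (cmod u) * e"
    using u by (simp add: e_def sgn_eq)
  have sub: "e * z \<in> R" if z: "z \<in> cball a r" and b: "\<bar>Im (u * (z - c))\<bar> \<le> h" for z
  proof -
    have "Im (u * (z - c)) = cmod u * (Im (e * z) - k)"
    proof -
      have "Im (u * z) = cmod u * Im (e * z)"
        by (subst ue) (simp add: algebra_simps)
      moreover have "cmod u * k = Im (u * c)" using u by (simp add: k_def)
      ultimately show ?thesis by (simp add: right_diff_distrib)
    qed
    with b have "cmod u * \<bar>Im (e * z) - k\<bar> \<le> h" by (simp add: abs_mult)
    then have "\<bar>Im (e * z) - k\<bar> \<le> h / cmod u" using u by (simp add: field_simps)
    moreover have "\<bar>Re (e * (z - a))\<bar> \<le> r"
    proof -
      have "\<bar>Re (e * (z - a))\<bar> \<le> cmod (e * (z - a))" by (rule abs_Re_le_cmod)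
      also have "\<dots> \<le> r" using z e by (simp add: norm_mult dist_norm norm_minus_commute)
      finally show ?thesis .
    qed
    then have "\<bar>Re (e * z) - Re (e * a)\<bar> \<le> r" by (simp only: right_diff_distrib minus_complex.sel)
    ultimately show ?thesis
      unfolding R_def in_cbox_complex_iff by (auto simp: abs_le_iff)
  qed
  have [measurable]: "R \<in> sets borel" by (simp add: R_def)
  have "emeasure lborel {z \<in> cball a r. \<bar>Im (u * (z - c))\<bar> \<le> h}
      \<le> (\<integral>\<^sup>+z. indicator R (e * z) \<partial>lborel)"
  proof -
    have m: "{z \<in> cball a r. \<bar>Im (u * (z - c))\<bar> \<le> h} \<in> sets lborel"
      by measurable
    show ?thesis
      unfolding nn_integral_indicator[OF m, symmetric]
      by (intro nn_integral_mono) (use sub in \<open>auto split: split_indicator\<close>)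
  qed
  also have "\<dots> = emeasure lborel R"
    by (subst nn_integral_rotate[OF _ e]) auto
  also have "\<dots> = ennreal (4 * r * h / cmod u)"
    unfolding R_def using r h
    by (subst emeasure_lborel_cbox)
       (auto simp: Basis_complex_def ennreal_mult[symmetric] field_simps)
  finally show ?thesis .
qed

section \<open>Pointwise growth in the Fock space\<close>

text \<open>
  Circles are parametrised from an arbitrary starting point \<open>z + w\<close>, so that one may later
  average over all \<open>w\<close> in a disk.
\<close>
lemma Cauchy_circle_mean:
  assumes hol: "G holomorphic_on UNIV"
  shows "((\<lambda>t. G (z + w * exp (2 * of_real pi * \<i> * of_real t))) has_integral G z) {0..1}"
proof -
  define K where "K = (\<lambda>\<zeta>. G (z + w * \<zeta>))"
  have holK: "K holomorphic_on cball 0 1"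
    unfolding K_def
    by (intro holomorphic_on_compose_gen[OF _ hol, unfolded o_def] holomorphic_intros) auto
  have "((\<lambda>u. K u / (u - 0)) has_contour_integral (2 * of_real pi * \<i> * K 0)) (circlepath 0 1)"
    using Cauchy_integral_circlepath_simple[OF holK, of 0] by simp
  then have "((\<lambda>t. K (circlepath 0 1 t) / circlepath 0 1 t *
      vector_derivative (circlepath 0 1) (at t within {0..1})) has_integral (2 * of_real pi * \<i> * K 0)) {0..1}"
    by (simp add: has_contour_integral_def)
  then have "((\<lambda>t. (2 * of_real pi * \<i>) * K (exp (2 * of_real pi * \<i> * of_real t))) has_integral
      (2 * of_real pi * \<i> * K 0)) {0..1}"
    by (rule has_integral_eq[rotated])
       (simp add: vector_derivative_circlepath01, simp add: circlepath)
  from has_integral_mult_right[OF this, of "inverse (2 * of_real pi * \<i>)"]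
  show ?thesis by (simp add: K_def field_simps)
qed

text \<open>
  Integrating the mean value property on the circle through \<open>z + w\<close> over all \<open>w\<close> in the unit
  disk and exchanging the integrals gives an average over rotated copies of the disk. By rotation
  invariance all of them give the same integral, which takes the place of polar coordinates.
\<close>
lemma area_mean_inequality:
  assumes hol: "G holomorphic_on UNIV"
  shows "ennreal (pi * cmod (G z)) \<le> (\<integral>\<^sup>+w. indicator (cball z 1) w * ennreal (cmod (G w)) \<partial>lborel)"
proof -
  define e where "e = (\<lambda>t::real. exp (2 * of_real pi * \<i> * of_real t) :: complex)"
  have e: "cmod (e t) = 1" for t by (simp add: e_def)
  have cont: "continuous_on UNIV G"
    using hol holomorphic_on_imp_continuous_on by blast
  have contc: "continuous_on A (\<lambda>x. G (f x))" if "continuous_on A f" for A and f :: "'a::topological_space \<Rightarrow> complex"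
    using continuous_on_compose2[OF cont that] by auto
  have circle: "ennreal (cmod (G z)) \<le> (\<integral>\<^sup>+t. indicator {0..1} t * ennreal (cmod (G (z + w * e t))) \<partial>lborel)" for w
  proof -
    have int: "set_integrable lborel {0..1} (\<lambda>t. G (z + w * e t))"
      unfolding e_def by (intro borel_integrable_atLeastAtMost' contc continuous_intros)
    have "G z = (LINT t:{0..1}|lborel. G (z + w * e t))"
      using set_borel_integral_eq_integral(2)[OF int] Cauchy_circle_mean[OF hol, of z w]
      by (simp add: e_def integral_unique)
    also have "ennreal (cmod \<dots>) \<le> (\<integral>\<^sup>+t. norm (indicator {0..1} t *\<^sub>R G (z + w * e t)) \<partial>lborel)"
      using int unfolding set_lebesgue_integral_def set_integrable_def by (rule integral_norm_bound_ennreal)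
    also have "\<dots> = (\<integral>\<^sup>+t. indicator {0..1} t * ennreal (cmod (G (z + w * e t))) \<partial>lborel)"
      by (intro nn_integral_cong) (auto split: split_indicator)
    finally show ?thesis .
  qed
  have [measurable]: "cball 0 1 \<in> sets (borel :: complex measure)" by simp
  have joint: "(\<lambda>p. indicator (cball 0 1) (fst p) * (indicator {0..1} (snd p) *
      ennreal (cmod (G (z + fst p * e (snd p)))))) \<in> borel_measurable (lborel \<Otimes>\<^sub>M lborel)"
  proof -
    have [measurable]: "(\<lambda>p. G (z + fst p * e (snd p))) \<in> borel_measurable (borel \<Otimes>\<^sub>M borel)"
      unfolding borel_prod e_def
      by (intro borel_measurable_continuous_onI contc continuous_intros)
    have "(\<lambda>p. indicator (cball 0 1) (fst p) * (indicator {0..1} (snd p) *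
      ennreal (cmod (G (z + fst p * e (snd p)))))) \<in> borel_measurable (borel \<Otimes>\<^sub>M borel)"
      by measurable
    then show ?thesis by (simp add: lborel_prod borel_prod)
  qed
  have [measurable]: "G \<in> borel_measurable borel"
    using cont by (rule borel_measurable_continuous_onI)
  have "ennreal (pi * cmod (G z)) = (\<integral>\<^sup>+w. indicator (cball 0 1) w * ennreal (cmod (G z)) \<partial>(lborel :: complex measure))"
    by (simp add: nn_integral_multc emeasure_cball ennreal_mult eval_unit_ball_vol)
  also have "\<dots> \<le> (\<integral>\<^sup>+w. indicator (cball 0 1) w *
      (\<integral>\<^sup>+t. indicator {0..1} t * ennreal (cmod (G (z + w * e t))) \<partial>lborel) \<partial>lborel)"
    by (intro nn_integral_mono mult_left_mono circle) auto
  also have "\<dots> = (\<integral>\<^sup>+w. \<integral>\<^sup>+t. indicator (cball 0 1) w *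
      (indicator {0..1} t * ennreal (cmod (G (z + w * e t)))) \<partial>lborel \<partial>lborel)"
  proof (intro nn_integral_cong nn_integral_cmult[symmetric])
    fix w
    have "(\<lambda>t. G (z + w * e t)) \<in> borel_measurable borel"
      unfolding e_def by (intro borel_measurable_continuous_onI contc continuous_intros)
    then show "(\<lambda>t. indicator {0..1} t * ennreal (cmod (G (z + w * e t)))) \<in> borel_measurable lborel"
      by measurable
  qed
  also have "\<dots> = (\<integral>\<^sup>+t. \<integral>\<^sup>+w. indicator (cball 0 1) w *
      (indicator {0..1} t * ennreal (cmod (G (z + w * e t)))) \<partial>lborel \<partial>lborel)"
    using lborel_pair.Fubini'[of "\<lambda>w t. indicator (cball 0 1) w *
      (indicator {0..1} t * ennreal (cmod (G (z + w * e t))))"] joint by (simp add: case_prod_beta)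
  also have "\<dots> = (\<integral>\<^sup>+t. indicator {0..1} t *
      (\<integral>\<^sup>+w. indicator (cball 0 1) w * ennreal (cmod (G (z + w))) \<partial>lborel) \<partial>(lborel :: real measure))"
  proof (rule nn_integral_cong)
    fix t :: real
    have rot: "(\<integral>\<^sup>+w. indicator (cball 0 1) (e t * w) * ennreal (cmod (G (z + e t * w))) \<partial>lborel)
       = (\<integral>\<^sup>+w. indicator (cball 0 1) w * ennreal (cmod (G (z + w))) \<partial>lborel)"
      by (rule nn_integral_rotate[OF _ e]) measurable
    have "(\<integral>\<^sup>+w. indicator (cball 0 1) w * (indicator {0..1} t * ennreal (cmod (G (z + w * e t)))) \<partial>lborel)
        = (\<integral>\<^sup>+w. indicator {0..1} t * (indicator (cball 0 1) (e t * w) * ennreal (cmod (G (z + e t * w)))) \<partial>lborel)"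
      by (intro nn_integral_cong) (auto split: split_indicator simp: norm_mult e mult.commute)
    also have "\<dots> = indicator {0..1} t * (\<integral>\<^sup>+w. indicator (cball 0 1) (e t * w) * ennreal (cmod (G (z + e t * w))) \<partial>lborel)"
      by (rule nn_integral_cmult) measurable
    finally show "(\<integral>\<^sup>+w. indicator (cball 0 1) w * (indicator {0..1} t * ennreal (cmod (G (z + w * e t)))) \<partial>lborel)
        = indicator {0..1} t * (\<integral>\<^sup>+w. indicator (cball 0 1) w * ennreal (cmod (G (z + w))) \<partial>lborel)"
      unfolding rot .
  qed
  also have "\<dots> = (\<integral>\<^sup>+w. indicator (cball 0 1) w * ennreal (cmod (G (z + w))) \<partial>lborel)"
    by (simp add: nn_integral_multc)
  also have "\<dots> = (\<integral>\<^sup>+w. indicator (cball z 1) w * ennreal (cmod (G w)) \<partial>lborel)"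
    by (subst (2) lborel_distr_plus[of z, symmetric])
       (simp add: nn_integral_distr indicator_def dist_norm)
  finally show ?thesis .
qed

text \<open>
  The area mean inequality for \<open>F^2\<close>; on the unit disk about \<open>z\<close> the weight is at least
  \<open>exp (- \<alpha> (|z| + 1)^2)\<close>.
\<close>
lemma fock_space_pointwise_bound:
  assumes F: "F \<in> fock_space \<alpha>" and \<alpha>: "\<alpha> > 0"
  shows "\<exists>K\<ge>0. \<forall>z. (cmod (F z))\<^sup>2 \<le> K * exp (\<alpha> * (cmod z + 1)\<^sup>2)"
proof -
  define f where "f = (\<lambda>z. (cmod (F z))\<^sup>2 * exp (- \<alpha> * (cmod z)\<^sup>2))"
  have hol: "F holomorphic_on UNIV" and int: "integrable lborel f"
    using F by (auto simp: fock_space_def f_def)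
  define K where "K = integral\<^sup>L lborel f"
  have f0: "f z \<ge> 0" for z by (simp add: f_def)
  have K0: "K \<ge> 0" unfolding K_def using f0 by simp
  have K: "(\<integral>\<^sup>+z. ennreal (f z) \<partial>lborel) = ennreal K"
    unfolding K_def using int f0 by (simp add: nn_integral_eq_integral)
  have [measurable]: "f \<in> borel_measurable borel" using int by auto
  show ?thesis
  proof (intro exI[of _ "K / pi"] conjI allI)
    show "K / pi \<ge> 0" using K0 by simp
    fix z
    define E where "E = exp (\<alpha> * (cmod z + 1)\<^sup>2)"
    have pt: "(cmod (F w))\<^sup>2 \<le> E * f w" if "w \<in> cball z 1" for w
    proof -
      have "cmod w \<le> cmod z + 1"
        using that norm_triangle_sub[of w z] by (auto simp: dist_norm norm_minus_commute)
      then have "(cmod w)\<^sup>2 \<le> (cmod z + 1)\<^sup>2" by (intro power_mono) auto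
      then have "1 \<le> exp (\<alpha> * (cmod z + 1)\<^sup>2 - \<alpha> * (cmod w)\<^sup>2)"
        using \<alpha> by simp
      then have "(cmod (F w))\<^sup>2 * 1 \<le> (cmod (F w))\<^sup>2 * exp (\<alpha> * (cmod z + 1)\<^sup>2 - \<alpha> * (cmod w)\<^sup>2)"
        by (intro mult_left_mono) auto
      then show ?thesis by (simp add: E_def f_def exp_diff exp_minus field_simps)
    qed
    have "ennreal (pi * (cmod (F z))\<^sup>2)
        \<le> (\<integral>\<^sup>+w. indicator (cball z 1) w * ennreal ((cmod (F w))\<^sup>2) \<partial>lborel)"
      using area_mean_inequality[of "\<lambda>w. (F w)\<^sup>2" z] hol
      by (simp add: norm_power holomorphic_on_power)
    also have "\<dots> \<le> (\<integral>\<^sup>+w. ennreal E * ennreal (f w) \<partial>lborel)"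
    proof (intro nn_integral_mono)
      fix w
      have "ennreal ((cmod (F w))\<^sup>2) \<le> ennreal E * ennreal (f w)" if "w \<in> cball z 1"
        using pt[OF that] by (simp add: ennreal_mult'[symmetric] E_def ennreal_leI)
      then show "indicator (cball z 1) w * ennreal ((cmod (F w))\<^sup>2) \<le> ennreal E * ennreal (f w)"
        by (auto split: split_indicator)
    qed
    also have "\<dots> = ennreal (E * K)"
      by (simp add: nn_integral_cmult K ennreal_mult' E_def)
    finally have "pi * (cmod (F z))\<^sup>2 \<le> E * K"
      using K0 by (simp add: E_def)
    then show "(cmod (F z))\<^sup>2 \<le> K / pi * exp (\<alpha> * (cmod z + 1)\<^sup>2)"
      by (simp add: E_def field_simps)
  qed
qed

text \<open>
  Cauchy estimates on unit circles turn the pointwise bound into bounds for the first two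
  derivatives. They enlarge \<open>|z|\<close> by a fixed amount, and a slightly larger exponent \<open>b > \<alpha> / 2\<close>
  absorbs this. The second derivative enters only through the remainder of Taylor's formula.
\<close>
lemma fock_space_growth:
  assumes F: "F \<in> fock_space \<alpha>" and \<alpha>: "\<alpha> > 0" and b: "\<alpha> / 2 < b"
  shows "\<exists>C\<ge>0. \<forall>z. cmod (F z) \<le> C * exp (b * (cmod z)\<^sup>2) \<and>
            cmod (deriv F z) \<le> C * exp (b * (cmod z)\<^sup>2) \<and>
            (\<forall>w\<in>cball z 1. cmod (F w - F z - deriv F z * (w - z)) \<le> C * exp (b * (cmod z)\<^sup>2) * (cmod (w - z))\<^sup>2)"
proof -
  have hol: "F holomorphic_on UNIV" using F by (simp add: fock_space_def)
  obtain K where K0: "K \<ge> 0" and K: "\<And>z. (cmod (F z))\<^sup>2 \<le> K * exp (\<alpha> * (cmod z + 1)\<^sup>2)"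
    using fock_space_pointwise_bound[OF F \<alpha>] by blast
  define d where "d = b - \<alpha> / 2"
  define D where "D = 9 * \<alpha>\<^sup>2 / (4 * d) + 9 * \<alpha> / 2"
  have d: "d > 0" using b by (simp add: d_def)
  have quad: "\<alpha> / 2 * (x + 3)\<^sup>2 \<le> b * x\<^sup>2 + D" for x :: real
  proof -
    \<comment> \<open>Completing the square absorbs the linear term \<open>3 \<alpha> x\<close>.\<close>
    have "0 \<le> d * (x - 3 * \<alpha> / (2 * d))\<^sup>2" using d by simp
    also have "\<dots> = d * x\<^sup>2 - 3 * \<alpha> * x + 9 * \<alpha>\<^sup>2 / (4 * d)"
      using d by (simp add: power2_eq_square field_simps)
    finally show ?thesis
      by (simp add: D_def d_def power2_eq_square algebra_simps)
  qed
  define A where "A = sqrt K * exp D"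
  have A0: "A \<ge> 0" using K0 by (simp add: A_def)
  have near: "cmod (F w) \<le> A * exp (b * (cmod z)\<^sup>2)" if w: "w \<in> cball z 2" for w z
  proof (rule power2_le_imp_le)
    have "cmod w \<le> cmod z + 2"
      using w norm_triangle_sub[of w z] by (auto simp: dist_norm norm_minus_commute)
    then have "(cmod w + 1)\<^sup>2 \<le> (cmod z + 3)\<^sup>2" by (intro power_mono) auto
    then have "\<alpha> * (cmod w + 1)\<^sup>2 \<le> 2 * (\<alpha> / 2 * (cmod z + 3)\<^sup>2)" using \<alpha> by simp
    also have "\<dots> \<le> 2 * (b * (cmod z)\<^sup>2 + D)" using quad[of "cmod z"] by simp
    finally have "(cmod (F w))\<^sup>2 \<le> K * exp (2 * (b * (cmod z)\<^sup>2 + D))"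
      using K[of w] K0 by (meson exp_le_cancel_iff mult_left_mono order_trans)
    also have "\<dots> = (A * exp (b * (cmod z)\<^sup>2))\<^sup>2"
      using K0 by (simp add: A_def power_mult_distrib exp_double[symmetric] exp_add algebra_simps)
    finally show "(cmod (F w))\<^sup>2 \<le> (A * exp (b * (cmod z)\<^sup>2))\<^sup>2" .
  qed (simp add: A0)
  have cauchy: "cmod ((deriv ^^ n) F w) \<le> fact n * (A * exp (b * (cmod z)\<^sup>2))" if w: "w \<in> cball z 1" for n w z
  proof -
    have "cmod ((deriv ^^ n) F w) \<le> fact n * (A * exp (b * (cmod z)\<^sup>2)) / 1 ^ n"
    proof (rule Cauchy_inequality)
      show "F holomorphic_on ball w 1" using hol holomorphic_on_subset by blast
      show "continuous_on (cball w 1) F"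
        using hol holomorphic_on_imp_continuous_on continuous_on_subset by blast
      fix x assume x: "cmod (w - x) = 1"
      have "dist z x \<le> dist z w + dist w x" by (rule dist_triangle)
      then have "x \<in> cball z 2" using w x by (simp add: dist_norm)
      then show "cmod (F x) \<le> A * exp (b * (cmod z)\<^sup>2)" by (rule near)
    qed simp
    then show ?thesis by simp
  qed
  have der: "((deriv ^^ n) F has_field_derivative (deriv ^^ Suc n) F x) (at x within S)" for n x S
    using holomorphic_derivI[OF holomorphic_higher_deriv[OF hol open_UNIV], of x n]
    by (simp add: has_field_derivative_at_within)
  have taylor: "cmod (F w - F z - deriv F z * (w - z)) \<le> 2 * (A * exp (b * (cmod z)\<^sup>2)) * (cmod (w - z))\<^sup>2"
    if w: "w \<in> cball z 1" for w z
  proof -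
    have "cmod ((deriv ^^ 0) F w - (\<Sum>i\<le>1. (deriv ^^ i) F z * (w - z) ^ i / fact i))
        \<le> 2 * (A * exp (b * (cmod z)\<^sup>2)) * cmod (w - z) ^ Suc 1 / fact 1"
      by (rule complex_Taylor[where S = "cball z 1"])
         (use w cauchy[of _ z "Suc 1"] der in auto)
    then show ?thesis by (simp add: power2_eq_square algebra_simps)
  qed
  show ?thesis
  proof (intro exI[of _ "2 * A"] conjI allI ballI)
    fix z
    have le: "A * exp (b * (cmod z)\<^sup>2) \<le> 2 * A * exp (b * (cmod z)\<^sup>2)" using A0 by simp
    show "cmod (F z) \<le> 2 * A * exp (b * (cmod z)\<^sup>2)"
      using near[of z z] le by simp
    show "cmod (deriv F z) \<le> 2 * A * exp (b * (cmod z)\<^sup>2)"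
      using cauchy[of z z 1] le by simp
    fix w assume "w \<in> cball z 1"
    from taylor[OF this]
    show "cmod (F w - F z - deriv F z * (w - z)) \<le> 2 * A * exp (b * (cmod z)\<^sup>2) * (cmod (w - z))\<^sup>2"
      by (simp add: mult.assoc)
  qed (use A0 in simp)
qed

text \<open>
  A partial converse of the growth bound: the square of the modulus grows with exponent
  \<open>2 b < \<beta>\<close>, and so a Gaussian is left over after multiplication by the weight.
\<close>
lemma in_fock_space_if_growth:
  assumes hol: "F holomorphic_on UNIV" and b: "2 * b < \<beta>"
    and bd: "\<And>z. cmod (F z) \<le> C * exp (b * (cmod z)\<^sup>2)"
  shows "F \<in> fock_space \<beta>"
proof -
  have C0: "C \<ge> 0" using order_trans[OF norm_ge_zero bd[of 0]] by simp
  have [measurable]: "F \<in> borel_measurable borel"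
    using hol holomorphic_on_imp_continuous_on by (intro borel_measurable_continuous_onI)
  have "integrable lborel (\<lambda>z. C\<^sup>2 * exp (- (\<beta> - 2 * b) * (cmod z)\<^sup>2))"
    using b by (intro integrable_mult_right integrable_gaussian_complex) auto
  then have "integrable lborel (\<lambda>z. (cmod (F z))\<^sup>2 * exp (- \<beta> * (cmod z)\<^sup>2))"
  proof (rule Bochner_Integration.integrable_bound)
    show "AE z in lborel. norm ((cmod (F z))\<^sup>2 * exp (- \<beta> * (cmod z)\<^sup>2))
        \<le> norm (C\<^sup>2 * exp (- (\<beta> - 2 * b) * (cmod z)\<^sup>2))"
    proof (rule AE_I2)
      fix z
      have "(cmod (F z))\<^sup>2 * exp (- \<beta> * (cmod z)\<^sup>2) \<le> (C * exp (b * (cmod z)\<^sup>2))\<^sup>2 * exp (- \<beta> * (cmod z)\<^sup>2)"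
        by (intro mult_right_mono power_mono bd) auto
      also have "\<dots> = C\<^sup>2 * exp (- (\<beta> - 2 * b) * (cmod z)\<^sup>2)"
        by (simp add: power_mult_distrib exp_double[symmetric] exp_add[symmetric] algebra_simps)
      finally show "norm ((cmod (F z))\<^sup>2 * exp (- \<beta> * (cmod z)\<^sup>2))
        \<le> norm (C\<^sup>2 * exp (- (\<beta> - 2 * b) * (cmod z)\<^sup>2))" by simp
    qed
  qed measurable
  then show ?thesis using hol by (simp add: fock_space_def)
qed

section \<open>Functions of equal modulus at the vertices of a triangle\<close>

text \<open>
  The affine function \<open>w \<mapsto> g + 2 Re (P (w - c))\<close> has values of size at most \<open>e\<close> at three
  points. Subtracting them bounds \<open>Re (P u)\<close> and \<open>Re (P v)\<close> for two edges \<open>u\<close> and \<open>v\<close>, and Cramer's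
  rule recovers \<open>P\<close> with the determinant \<open>Im (cnj u * v)\<close>, twice the signed area.
\<close>
lemma three_point_estimate_affine:
  fixes P c z1 z2 z3 :: complex and g e r \<epsilon> :: real
  assumes r: "r > 0" "r \<le> 1" and \<epsilon>: "\<epsilon> > 0" "\<epsilon> \<le> 1"
    and z: "z1 \<in> cball c r" "z2 \<in> cball c r" "z3 \<in> cball c r"
    and area: "\<epsilon> * r\<^sup>2 \<le> \<bar>Im (cnj (z2 - z1) * (z3 - z1))\<bar>"
    and e: "\<bar>g + 2 * Re (P * (z1 - c))\<bar> \<le> e" "\<bar>g + 2 * Re (P * (z2 - c))\<bar> \<le> e"
           "\<bar>g + 2 * Re (P * (z3 - c))\<bar> \<le> e"
  shows "cmod P \<le> 4 * e / (\<epsilon> * r)" and "\<bar>g\<bar> \<le> 9 * e / \<epsilon>"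
proof -
  define u where "u = z2 - z1"
  define v where "v = z3 - z1"
  have e0: "e \<ge> 0" using e(1) by linarith
  have "dist z1 z2 \<le> dist c z1 + dist c z2" "dist z1 z3 \<le> dist c z1 + dist c z3"
    by (metis dist_commute dist_triangle)+
  then have uv: "cmod u \<le> 2 * r" "cmod v \<le> 2 * r"
    using z by (auto simp: u_def v_def dist_norm norm_minus_commute)
  have Pu: "\<bar>Re (P * u)\<bar> \<le> e" and Pv: "\<bar>Re (P * v)\<bar> \<le> e"
  proof -
    have "2 * Re (P * u) = (g + 2 * Re (P * (z2 - c))) - (g + 2 * Re (P * (z1 - c)))"
         "2 * Re (P * v) = (g + 2 * Re (P * (z3 - c))) - (g + 2 * Re (P * (z1 - c)))"
      by (simp_all add: u_def v_def algebra_simps)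
    then show "\<bar>Re (P * u)\<bar> \<le> e" "\<bar>Re (P * v)\<bar> \<le> e" using e by linarith+
  qed
  have cramer: "of_real (Re (P * u)) * v - of_real (Re (P * v)) * u = cnj P * \<i> * of_real (Im (cnj u * v))"
    by (simp add: complex_eq_iff algebra_simps)
  have "cmod P * \<bar>Im (cnj u * v)\<bar> = cmod (of_real (Re (P * u)) * v - of_real (Re (P * v)) * u)"
    unfolding cramer by (simp only: norm_mult norm_of_real norm_ii complex_mod_cnj mult_1_right)
  also have "\<dots> \<le> \<bar>Re (P * u)\<bar> * cmod v + \<bar>Re (P * v)\<bar> * cmod u"
    using norm_triangle_ineq4[of "of_real (Re (P * u)) * v" "of_real (Re (P * v)) * u"]
    by (simp add: norm_mult del: Re_complex_of_real times_complex.sel)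
  also have "\<dots> \<le> e * (2 * r) + e * (2 * r)"
    by (intro add_mono mult_mono Pu Pv uv e0) auto
  finally have "cmod P * \<bar>Im (cnj u * v)\<bar> \<le> 4 * e * r" by simp
  moreover have "cmod P * (\<epsilon> * r\<^sup>2) \<le> cmod P * \<bar>Im (cnj u * v)\<bar>"
    using area by (intro mult_left_mono) (auto simp: u_def v_def)
  ultimately have "(cmod P * (\<epsilon> * r)) * r \<le> (4 * e) * r"
    by (simp add: power2_eq_square algebra_simps)
  then have "cmod P * (\<epsilon> * r) \<le> 4 * e" using r by simp
  then show P: "cmod P \<le> 4 * e / (\<epsilon> * r)" using r \<epsilon> by (simp add: pos_le_divide_eq)
  have "\<bar>Re (P * (z1 - c))\<bar> \<le> cmod P * cmod (z1 - c)"
    by (metis abs_Re_le_cmod norm_mult)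
  also have "\<dots> \<le> 4 * e / (\<epsilon> * r) * r"
    using P z(1) e0 r \<epsilon> by (intro mult_mono) (auto simp: dist_norm norm_minus_commute)
  also have "\<dots> = 4 * e / \<epsilon>" using r by simp
  finally have "\<bar>Re (P * (z1 - c))\<bar> \<le> 4 * e / \<epsilon>" .
  moreover have "8 * e / \<epsilon> = 2 * (4 * e / \<epsilon>)" by simp
  ultimately have "\<bar>g\<bar> \<le> e + 8 * e / \<epsilon>" using e(1) by linarith
  moreover have "e \<le> e / \<epsilon>" using e0 \<epsilon> by (simp add: pos_le_divide_eq mult_left_le)
  moreover have "9 * e / \<epsilon> = e / \<epsilon> + 8 * e / \<epsilon>" by (simp add: add_divide_distrib[symmetric])
  ultimately show "\<bar>g\<bar> \<le> 9 * e / \<epsilon>" by linarith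
qed

text \<open>
  For \<open>a = F c\<close>, \<open>b = F' c\<close> and the Taylor remainder \<open>R\<close>, this says that \<open>|F|^2\<close> is affine near
  \<open>c\<close> up to a quadratic error.
\<close>
lemma cmod_square_expansion:
  fixes a b h R :: complex
  assumes a: "cmod a \<le> B" and b: "cmod b \<le> B" and h: "cmod h \<le> 1" and R: "cmod R \<le> B * (cmod h)\<^sup>2"
  shows "\<bar>(cmod (a + b * h + R))\<^sup>2 - (cmod a)\<^sup>2 - 2 * Re (b * cnj a * h)\<bar> \<le> 6 * B\<^sup>2 * (cmod h)\<^sup>2"
proof -
  have B0: "B \<ge> 0" using order_trans[OF norm_ge_zero a] .
  have h2: "(cmod h)\<^sup>2 \<le> 1" using h by (simp add: power_le_one)
  have id: "(cmod (x + y))\<^sup>2 = (cmod x)\<^sup>2 + (cmod y)\<^sup>2 + 2 * Re (y * cnj x)" for x y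
    unfolding cmod_power2 by (simp add: power2_eq_square algebra_simps)
  have "(cmod (a + b * h + R))\<^sup>2 - (cmod a)\<^sup>2 - 2 * Re (b * cnj a * h)
      = (cmod (b * h))\<^sup>2 + (cmod R)\<^sup>2 + 2 * Re (R * cnj a) + 2 * Re (R * cnj (b * h))"
    unfolding id by (simp add: algebra_simps)
  moreover have "(cmod (b * h))\<^sup>2 \<le> B\<^sup>2 * (cmod h)\<^sup>2"
    using b by (simp add: norm_mult power_mult_distrib mult_right_mono power_mono)
  moreover have R1: "cmod R \<le> B" using R mult_left_mono[OF h2 B0] by simp
  moreover have "(cmod R)\<^sup>2 \<le> B\<^sup>2 * (cmod h)\<^sup>2"
    using mult_mono[OF R1 R] B0 by (simp add: power2_eq_square mult.assoc)
  moreover have "\<bar>Re (R * cnj a)\<bar> \<le> B\<^sup>2 * (cmod h)\<^sup>2"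
  proof -
    have "\<bar>Re (R * cnj a)\<bar> \<le> cmod R * cmod a" by (metis abs_Re_le_cmod complex_mod_cnj norm_mult)
    also have "\<dots> \<le> (B * (cmod h)\<^sup>2) * B" by (intro mult_mono R a) (auto simp: B0)
    finally show ?thesis by (simp add: power2_eq_square algebra_simps)
  qed
  moreover have "\<bar>Re (R * cnj (b * h))\<bar> \<le> B\<^sup>2 * (cmod h)\<^sup>2"
  proof -
    have "\<bar>Re (R * cnj (b * h))\<bar> \<le> cmod R * cmod (b * h)" by (metis abs_Re_le_cmod complex_mod_cnj norm_mult)
    also have "\<dots> \<le> (B * (cmod h)\<^sup>2) * B"
      using mult_mono[OF b h] B0 by (intro mult_mono R) (auto simp: norm_mult)
    finally show ?thesis by (simp add: power2_eq_square algebra_simps)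
  qed
  moreover have "(cmod (b * h))\<^sup>2 \<ge> 0" "(cmod R)\<^sup>2 \<ge> 0" by simp_all
  ultimately show ?thesis by linarith
qed

text \<open>
  The difference \<open>|F|^2 - |H|^2\<close> is zero at the three points, so its affine part at \<open>c\<close> has
  values there no larger than the quadratic error \<open>12 B^2 r^2\<close>.
\<close>
lemma three_point_estimate:
  fixes F H :: "complex \<Rightarrow> complex"
  assumes r: "r > 0" "r \<le> 1" and \<epsilon>: "\<epsilon> > 0" "\<epsilon> \<le> 1"
    and z: "z1 \<in> cball c r" "z2 \<in> cball c r" "z3 \<in> cball c r"
    and area: "\<epsilon> * r\<^sup>2 \<le> \<bar>Im (cnj (z2 - z1) * (z3 - z1))\<bar>"
    and eq: "cmod (F z1) = cmod (H z1)" "cmod (F z2) = cmod (H z2)" "cmod (F z3) = cmod (H z3)"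
    and F: "cmod (F c) \<le> B" "cmod F' \<le> B"
           "\<And>w. w \<in> cball c 1 \<Longrightarrow> cmod (F w - F c - F' * (w - c)) \<le> B * (cmod (w - c))\<^sup>2"
    and H: "cmod (H c) \<le> B" "cmod H' \<le> B"
           "\<And>w. w \<in> cball c 1 \<Longrightarrow> cmod (H w - H c - H' * (w - c)) \<le> B * (cmod (w - c))\<^sup>2"
  shows "cmod (F' * cnj (F c) - H' * cnj (H c)) \<le> 48 * B\<^sup>2 * r / \<epsilon>"
    and "\<bar>(cmod (F c))\<^sup>2 - (cmod (H c))\<^sup>2\<bar> \<le> 108 * B\<^sup>2 * r\<^sup>2 / \<epsilon>"
proof -
  define g where "g = (cmod (F c))\<^sup>2 - (cmod (H c))\<^sup>2"
  define P where "P = F' * cnj (F c) - H' * cnj (H c)"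
  have aff: "\<bar>g + 2 * Re (P * (w - c))\<bar> \<le> 12 * B\<^sup>2 * r\<^sup>2"
    if w: "w \<in> cball c r" and eq: "cmod (F w) = cmod (H w)" for w
  proof -
    have d: "cmod (w - c) \<le> r" using w by (simp add: dist_norm norm_minus_commute)
    have w1: "w \<in> cball c 1" using d r by (simp add: dist_norm norm_minus_commute)
    have d1: "cmod (w - c) \<le> 1" using d r by simp
    have "\<bar>(cmod (F w))\<^sup>2 - (cmod (F c))\<^sup>2 - 2 * Re (F' * cnj (F c) * (w - c))\<bar> \<le> 6 * B\<^sup>2 * (cmod (w - c))\<^sup>2"
         "\<bar>(cmod (H w))\<^sup>2 - (cmod (H c))\<^sup>2 - 2 * Re (H' * cnj (H c) * (w - c))\<bar> \<le> 6 * B\<^sup>2 * (cmod (w - c))\<^sup>2"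
      using cmod_square_expansion[OF F(1,2) d1 F(3)[OF w1]] cmod_square_expansion[OF H(1,2) d1 H(3)[OF w1]]
      by (simp_all add: algebra_simps del: times_complex.sel)
    moreover have "Re (P * (w - c)) = Re (F' * cnj (F c) * (w - c)) - Re (H' * cnj (H c) * (w - c))"
      by (simp add: P_def left_diff_distrib del: times_complex.sel)
    ultimately have "\<bar>g + 2 * Re (P * (w - c))\<bar> \<le> 12 * B\<^sup>2 * (cmod (w - c))\<^sup>2"
      unfolding g_def eq by linarith
    also have "\<dots> \<le> 12 * B\<^sup>2 * r\<^sup>2" using d by (intro mult_left_mono power_mono) auto
    finally show ?thesis .
  qed
  note * = three_point_estimate_affine[OF r \<epsilon> z area aff[OF z(1) eq(1)] aff[OF z(2) eq(2)] aff[OF z(3) eq(3)]]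
  show "cmod (F' * cnj (F c) - H' * cnj (H c)) \<le> 48 * B\<^sup>2 * r / \<epsilon>"
    using *(1) r \<epsilon> by (simp add: P_def power2_eq_square field_simps)
  show "\<bar>(cmod (F c))\<^sup>2 - (cmod (H c))\<^sup>2\<bar> \<le> 108 * B\<^sup>2 * r\<^sup>2 / \<epsilon>"
    using *(2) by (simp add: g_def)
qed

section \<open>Degenerate random triangles\<close>

text \<open>
  The joint law of independent variables is a product measure, so a bound on all slices bounds
  the whole. The maps \<open>g\<close> and \<open>h\<close> are there because \<open>indep_var\<close> relates two
  variables of the same type only: a pair of points and a single point are both read off from
  restrictions of the random family.
\<close>
lemma (in prob_space) emeasure_indep_slices_le:
  assumes indep: "indep_var S' U T' V"
    and g [measurable]: "g \<in> S' \<rightarrow>\<^sub>M S" and h [measurable]: "h \<in> T' \<rightarrow>\<^sub>M T"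
    and A [measurable]: "A \<in> sets (S \<Otimes>\<^sub>M T)"
    and slice: "\<And>x. x \<in> space S \<Longrightarrow> emeasure (distr M T (\<lambda>w. h (V w))) (Pair x -` A) \<le> p"
  shows "emeasure M {w \<in> space M. (g (U w), h (V w)) \<in> A} \<le> p"
proof -
  have U [measurable]: "U \<in> M \<rightarrow>\<^sub>M S'" and V [measurable]: "V \<in> M \<rightarrow>\<^sub>M T'"
    and prod: "distr M S' U \<Otimes>\<^sub>M distr M T' V = distr M (S' \<Otimes>\<^sub>M T') (\<lambda>w. (U w, V w))"
    using indep by (auto simp: indep_var_distribution_eq)
  interpret DU: prob_space "distr M S' U" by (rule prob_space_distr[OF U])
  interpret DV: prob_space "distr M T' V" by (rule prob_space_distr[OF V])
  define A' where "A' = {q \<in> space (S' \<Otimes>\<^sub>M T'). (g (fst q), h (snd q)) \<in> A}"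
  have A': "A' \<in> sets (S' \<Otimes>\<^sub>M T')" unfolding A'_def by measurable
  have spaceU: "U w \<in> space S'" and spaceV: "V w \<in> space T'" if "w \<in> space M" for w
    using that measurable_space[OF U] measurable_space[OF V] by auto
  have "emeasure M {w \<in> space M. (g (U w), h (V w)) \<in> A} = emeasure (distr M (S' \<Otimes>\<^sub>M T') (\<lambda>w. (U w, V w))) A'"
    using A' by (subst emeasure_distr)
      (auto intro!: arg_cong[where f="emeasure M"] simp: A'_def space_pair_measure spaceU spaceV)
  also have "\<dots> = (\<integral>\<^sup>+x. emeasure (distr M T' V) (Pair x -` A') \<partial>distr M S' U)"
    unfolding prod[symmetric] using A'
    by (intro DV.emeasure_pair_measure_alt) (simp cong: sets_pair_measure_cong)
  also have "\<dots> \<le> (\<integral>\<^sup>+x. p \<partial>distr M S' U)"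
  proof (intro nn_integral_mono)
    fix x assume "x \<in> space (distr M S' U)"
    then have x: "x \<in> space S'" by simp
    then have gx: "g x \<in> space S" using measurable_space[OF g] by simp
    have "emeasure (distr M T' V) (Pair x -` A') = emeasure M (V -` (Pair x -` A') \<inter> space M)"
      using sets_Pair1[OF A'] by (intro emeasure_distr) auto
    also have "V -` (Pair x -` A') \<inter> space M = (\<lambda>w. h (V w)) -` (Pair (g x) -` A) \<inter> space M"
      using x by (auto simp: A'_def space_pair_measure spaceV)
    also have "emeasure M \<dots> = emeasure (distr M T (\<lambda>w. h (V w))) (Pair (g x) -` A)"
      using sets_Pair1[OF A] by (intro emeasure_distr[symmetric]) auto
    also have "\<dots> \<le> p" by (rule slice[OF gx])
    finally show "emeasure (distr M T' V) (Pair x -` A') \<le> p" .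
  qed
  also have "\<dots> = p"
    using DU.emeasure_space_1 by simp
  finally show ?thesis .
qed

lemma emeasure_uniform_disk_le:
  fixes c :: complex
  assumes r: "r > 0" and B: "B \<in> sets borel" and m: "m \<ge> 0"
    and le: "emeasure lborel (cball c r \<inter> B) \<le> ennreal m"
  shows "emeasure (uniform_measure lborel (cball c r)) B \<le> ennreal (m / (pi * r\<^sup>2))"
proof -
  have "emeasure (uniform_measure lborel (cball c r)) B
      = emeasure lborel (cball c r \<inter> B) / ennreal (pi * r\<^sup>2)"
    using r B by (simp add: emeasure_cball eval_unit_ball_vol)
  also have "\<dots> \<le> ennreal m / ennreal (pi * r\<^sup>2)"
    by (intro divide_right_mono_ennreal le)
  also have "\<dots> = ennreal (m / (pi * r\<^sup>2))"
    using r m by (simp add: divide_ennreal)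
  finally show ?thesis .
qed

text \<open>
  The quantity \<open>Im (cnj (z2 - z1) * (z3 - z1))\<close> is twice the signed area of the triangle.
  Dividing it by \<open>r^2\<close> makes it invariant under scaling. The condition that the points lie in
  the disk is included because uniform random points satisfy it only almost surely.
\<close>
definition fat_triangle :: "complex \<Rightarrow> real \<Rightarrow> real \<Rightarrow> complex \<Rightarrow> complex \<Rightarrow> complex \<Rightarrow> bool" where
  "fat_triangle c r \<epsilon> z1 z2 z3 \<longleftrightarrow> z1 \<in> cball c r \<and> z2 \<in> cball c r \<and> z3 \<in> cball c r \<and>
     \<epsilon> * r\<^sup>2 \<le> \<bar>Im (cnj (z2 - z1) * (z3 - z1))\<bar>"

lemma borel_measurable_cnj [measurable]: "cnj \<in> borel_measurable borel"
  by (intro borel_measurable_continuous_onI continuous_intros)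

lemma pred_fat_triangle [measurable]:
  assumes [measurable]: "X1 \<in> borel_measurable M" "X2 \<in> borel_measurable M" "X3 \<in> borel_measurable M"
  shows "Measurable.pred M (\<lambda>w. fat_triangle c r \<epsilon> (X1 w) (X2 w) (X3 w))"
proof -
  have [measurable]: "cball c r \<in> sets borel" by simp
  show ?thesis unfolding fat_triangle_def by measurable
qed

text \<open>
  The first two points are within \<open>\<rho> r\<close> of each other with probability at most \<open>\<rho>^2\<close>. Otherwise
  the triangle can only be thin if the third point is in a strip about the line through the other
  two. Its half-width is the threshold \<open>\<rho>^2 r^2\<close> divided by the distance of these two, hence at
  most \<open>\<rho> r\<close>, so the conditional probability of this is at most \<open>4 \<rho> / \<pi>\<close>.
\<close>
lemma (in prob_space) prob_thin_triangle_le: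
  assumes ind: "indep_vars (\<lambda>_. borel) Z I" and I: "i \<in> I" "j \<in> I" "k \<in> I"
    and ne: "i \<noteq> j" "i \<noteq> k" "j \<noteq> k"
    and unif: "\<And>n. n \<in> {i, j, k} \<Longrightarrow> distr M borel (Z n) = uniform_measure lborel (cball c r)"
    and r: "r > 0" and \<rho>: "0 < \<rho>" "\<rho> \<le> 1"
  shows "prob {w \<in> space M. \<not> fat_triangle c r (\<rho>\<^sup>2) (Z i w) (Z j w) (Z k w)} \<le> 3 * \<rho>"
proof -
  define X1 where "X1 = Z i"
  define X2 where "X2 = Z j"
  define X3 where "X3 = Z k"
  note X_def = X1_def X2_def X3_def
  have d: "distr M borel X1 = uniform_measure lborel (cball c r)"
       "distr M borel X2 = uniform_measure lborel (cball c r)"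
       "distr M borel X3 = uniform_measure lborel (cball c r)"
    using unif by (auto simp: X_def)
  have [measurable]: "X1 \<in> borel_measurable M" "X2 \<in> borel_measurable M" "X3 \<in> borel_measurable M"
    using ind I by (auto simp: X_def indep_vars_def)
  define R where "R = (\<lambda>J w. restrict (\<lambda>n. Z n w) J)"
  have ind12: "indep_var (PiM {i} (\<lambda>_. borel)) (R {i}) (PiM {j} (\<lambda>_. borel)) (R {j})"
    and ind123: "indep_var (PiM {i, j} (\<lambda>_. borel)) (R {i, j}) (PiM {k} (\<lambda>_. borel)) (R {k})"
    unfolding R_def using I ne by (auto intro!: indep_var_restrict[OF ind])
  have R: "R {i} w i = X1 w" "R {j} w j = X2 w" "R {k} w k = X3 w" "R {i, j} w i = X1 w" "R {i, j} w j = X2 w" for w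
    by (simp_all add: R_def X_def)
  have [measurable]: "cball c r \<in> sets borel" by simp
  define N where "N = (\<lambda>X. {w \<in> space M. X w \<notin> cball c r})"
  define A where "A = {w \<in> space M. cmod (X2 w - X1 w) \<le> \<rho> * r}"
  define B where "B = {w \<in> space M. \<rho> * r \<le> cmod (X2 w - X1 w) \<and>
      \<bar>Im (cnj (X2 w - X1 w) * (X3 w - X1 w))\<bar> \<le> \<rho>\<^sup>2 * r\<^sup>2}"
  have meas: "N X1 \<in> events" "N X2 \<in> events" "N X3 \<in> events" "A \<in> events" "B \<in> events"
    unfolding N_def A_def B_def by measurable
  have N: "prob (N X) = 0" if X: "X \<in> borel_measurable M" "distr M borel X = uniform_measure lborel (cball c r)" for X
  proof -
    have "emeasure M (N X) = emeasure (distr M borel X) (- cball c r)"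
      using X(1) by (subst emeasure_distr) (auto simp: N_def intro!: arg_cong[where f="emeasure M"])
    also have "\<dots> = 0"
      unfolding X(2) by (subst emeasure_uniform_measure) auto
    finally show ?thesis by (simp add: measure_def)
  qed
  have PA: "prob A \<le> \<rho>\<^sup>2"
  proof -
    define S where "S = {p :: complex \<times> complex. cmod (snd p - fst p) \<le> \<rho> * r}"
    have "S = {p \<in> space (borel \<Otimes>\<^sub>M borel). cmod (snd p - fst p) \<le> \<rho> * r}"
      by (simp add: S_def space_pair_measure)
    also have "\<dots> \<in> sets (borel \<Otimes>\<^sub>M borel)" by measurable
    finally have S: "S \<in> sets (borel \<Otimes>\<^sub>M borel)" .
    have "emeasure M {w \<in> space M. (R {i} w i, R {j} w j) \<in> S} \<le> ennreal (\<rho>\<^sup>2)"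
    proof (rule emeasure_indep_slices_le[OF ind12 _ _ S, where g = "\<lambda>f. f i" and h = "\<lambda>f. f j"])
      fix x :: complex
      have eq: "Pair x -` S = cball x (\<rho> * r)"
        by (auto simp: S_def dist_norm norm_minus_commute)
      have "emeasure lborel (cball c r \<inter> cball x (\<rho> * r)) \<le> emeasure lborel (cball x (\<rho> * r))"
        by (intro emeasure_mono) auto
      also have "\<dots> = ennreal (pi * (\<rho> * r)\<^sup>2)"
        using r \<rho> by (simp add: emeasure_cball eval_unit_ball_vol)
      finally have "emeasure (uniform_measure lborel (cball c r)) (cball x (\<rho> * r))
          \<le> ennreal (pi * (\<rho> * r)\<^sup>2 / (pi * r\<^sup>2))"
        by (intro emeasure_uniform_disk_le r) auto
      then show "emeasure (distr M borel (\<lambda>w. R {j} w j)) (Pair x -` S) \<le> ennreal (\<rho>\<^sup>2)"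
        unfolding R d eq using r by (simp add: power_mult_distrib)
    qed simp_all
    then show ?thesis
      by (simp add: R A_def S_def emeasure_eq_measure)
  qed
  have PB: "prob B \<le> 4 * \<rho> / pi"
  proof -
    define S where "S = {p :: (complex \<times> complex) \<times> complex. \<rho> * r \<le> cmod (snd (fst p) - fst (fst p)) \<and>
      \<bar>Im (cnj (snd (fst p) - fst (fst p)) * (snd p - fst (fst p)))\<bar> \<le> \<rho>\<^sup>2 * r\<^sup>2}"
    have "S = {p \<in> space ((borel \<Otimes>\<^sub>M borel) \<Otimes>\<^sub>M borel). \<rho> * r \<le> cmod (snd (fst p) - fst (fst p)) \<and>
      \<bar>Im (cnj (snd (fst p) - fst (fst p)) * (snd p - fst (fst p)))\<bar> \<le> \<rho>\<^sup>2 * r\<^sup>2}"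
      by (simp add: S_def space_pair_measure)
    also have "\<dots> \<in> sets ((borel \<Otimes>\<^sub>M borel) \<Otimes>\<^sub>M borel)" by measurable
    finally have S: "S \<in> sets ((borel \<Otimes>\<^sub>M borel) \<Otimes>\<^sub>M borel)" .
    have "emeasure M {w \<in> space M. ((R {i, j} w i, R {i, j} w j), R {k} w k) \<in> S} \<le> ennreal (4 * \<rho> / pi)"
    proof (rule emeasure_indep_slices_le[OF ind123 _ _ S, where g = "\<lambda>f. (f i, f j)" and h = "\<lambda>f. f k"])
      fix p :: "complex \<times> complex"
      define u where "u = cnj (snd p - fst p)"
      show "emeasure (distr M borel (\<lambda>w. R {k} w k)) (Pair p -` S) \<le> ennreal (4 * \<rho> / pi)"
      proof (cases "\<rho> * r \<le> cmod u")
        case False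
        then have "Pair p -` S = {}" by (auto simp: S_def u_def simp del: complex_cnj_diff)
        then show ?thesis by simp
      next
        case True
        have pos: "0 < \<rho> * r" using r \<rho> by simp
        have u0: "u \<noteq> 0" using True pos by auto
        have eq: "Pair p -` S = {z. \<bar>Im (u * (z - fst p))\<bar> \<le> \<rho>\<^sup>2 * r\<^sup>2}"
          using True by (auto simp: S_def u_def simp del: complex_cnj_diff times_complex.sel minus_complex.sel)
        have Sm: "Pair p -` S \<in> sets borel"
          using sets_Pair1[OF S] .
        have "emeasure lborel (cball c r \<inter> Pair p -` S)
            = emeasure lborel {z \<in> cball c r. \<bar>Im (u * (z - fst p))\<bar> \<le> \<rho>\<^sup>2 * r\<^sup>2}"
          unfolding eq by (intro arg_cong[where f="emeasure lborel"]) auto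
        also have "\<dots> \<le> ennreal (4 * r * (\<rho>\<^sup>2 * r\<^sup>2) / cmod u)"
          using r by (intro emeasure_strip_le u0) auto
        also have "\<dots> \<le> ennreal (4 * r * (\<rho>\<^sup>2 * r\<^sup>2) / (\<rho> * r))"
          using True pos r \<rho> u0 by (intro ennreal_leI divide_left_mono mult_pos_pos) auto
        also have "4 * r * (\<rho>\<^sup>2 * r\<^sup>2) / (\<rho> * r) = 4 * \<rho> * r\<^sup>2"
          using r \<rho> by (simp add: power2_eq_square)
        finally have "emeasure (uniform_measure lborel (cball c r)) (Pair p -` S)
            \<le> ennreal (4 * \<rho> * r\<^sup>2 / (pi * r\<^sup>2))"
          using r \<rho> Sm by (intro emeasure_uniform_disk_le) auto
        then show ?thesis unfolding R d using r by simp
      qed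
    qed simp_all
    then show ?thesis
      using \<rho> by (simp add: R B_def S_def emeasure_eq_measure)
  qed
  have "{w \<in> space M. \<not> fat_triangle c r (\<rho>\<^sup>2) (Z i w) (Z j w) (Z k w)}
      \<subseteq> N X1 \<union> N X2 \<union> N X3 \<union> A \<union> B"
    by (auto simp: X_def fat_triangle_def N_def A_def B_def not_le)
  then have "prob {w \<in> space M. \<not> fat_triangle c r (\<rho>\<^sup>2) (Z i w) (Z j w) (Z k w)}
      \<le> prob (N X1 \<union> N X2 \<union> N X3 \<union> A \<union> B)"
    using meas by (intro finite_measure_mono) auto
  also have "\<dots> \<le> prob (N X1) + prob (N X2) + prob (N X3) + prob A + prob B"
    using meas by (intro order_trans[OF measure_Un_le] add_mono order_refl sets.Un) auto
  also have "\<dots> \<le> \<rho>\<^sup>2 + 4 * \<rho> / pi"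
    using PA PB N d by simp
  also have "\<dots> \<le> \<rho> + 2 * \<rho>"
  proof (rule add_mono)
    show "\<rho>\<^sup>2 \<le> \<rho>" using \<rho> by (simp add: power2_eq_square mult_left_le)
    have "4 \<le> 2 * pi" using pi_ge_two by simp
    then have "4 * \<rho> \<le> 2 * pi * \<rho>" using \<rho> by (intro mult_right_mono) auto
    then show "4 * \<rho> / pi \<le> 2 * \<rho>" by (simp add: divide_le_eq field_simps)
  qed
  finally show ?thesis by simp
qed

section \<open>Almost surely finitely many degenerate triangles\<close>

text \<open>
  The disk of radius \<open>n\<close> is covered by unit disks about Gaussian integers, since rounding both
  coordinates moves a point by at most \<open>1\<close>.
\<close>
lemma finite_density_card_disk:
  assumes fd: "finite_density \<Lambda>"
  shows "\<exists>N. \<forall>n::nat. finite (\<Lambda> \<inter> cball 0 n) \<and> card (\<Lambda> \<inter> cball 0 n) \<le> N * (2 * n + 1)\<^sup>2"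
proof -
  have fin: "finite (\<Lambda> \<inter> cball z 1)" for z using fd by (simp add: finite_density_def)
  obtain N where N: "\<And>z. card (\<Lambda> \<inter> cball z 1) \<le> N"
    using fd by (auto simp: finite_density_def bdd_above_def)
  show ?thesis
  proof (intro exI[of _ N] allI)
    fix n :: nat
    define I where "I = {- int n..int n} \<times> {- int n..int n}"
    define D where "D = (\<lambda>p. \<Lambda> \<inter> cball (Complex (of_int (fst p)) (of_int (snd p))) 1)"
    have near: "round x \<in> {- int n..int n}" if "\<bar>x\<bar> \<le> real n" for x :: real
    proof -
      have "\<bar>of_int (round x) - x\<bar> \<le> 1/2" by (rule of_int_round_abs_le)
      then have "real_of_int (round x) < real_of_int (int n + 1)" "real_of_int (- int n - 1) < real_of_int (round x)"
        using that by (simp_all add: abs_if split: if_splits)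
      then show ?thesis unfolding of_int_less_iff by simp
    qed
    have cover: "\<Lambda> \<inter> cball 0 n \<subseteq> (\<Union>p\<in>I. D p)"
    proof
      fix z assume z: "z \<in> \<Lambda> \<inter> cball 0 n"
      define p where "p = (round (Re z), round (Im z))"
      have "\<bar>Re z\<bar> \<le> real n" "\<bar>Im z\<bar> \<le> real n"
        using z abs_Re_le_cmod[of z] abs_Im_le_cmod[of z] by auto
      then have "p \<in> I" using near by (simp add: p_def I_def)
      moreover have "z \<in> D p"
      proof -
        have "dist (Complex (of_int (fst p)) (of_int (snd p))) z
            \<le> \<bar>of_int (round (Re z)) - Re z\<bar> + \<bar>of_int (round (Im z)) - Im z\<bar>"
          unfolding dist_norm by (rule order_trans[OF cmod_le]) (simp add: p_def)
        also have "\<dots> \<le> 1/2 + 1/2" by (intro add_mono of_int_round_abs_le)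
        finally show ?thesis using z by (simp add: D_def)
      qed
      ultimately show "z \<in> (\<Union>p\<in>I. D p)" by blast
    qed
    have finI: "finite I" by (simp add: I_def)
    have finU: "finite (\<Union>p\<in>I. D p)" unfolding D_def by (intro finite_UN_I finI fin)
    have "card (\<Lambda> \<inter> cball 0 n) \<le> card (\<Union>p\<in>I. D p)" using finU cover by (rule card_mono)
    also have "\<dots> \<le> (\<Sum>p\<in>I. card (D p))" by (rule card_UN_le[OF finI])
    also have "\<dots> \<le> (\<Sum>p\<in>I. N)" by (intro sum_mono) (simp add: D_def N)
    also have "\<dots> = N * (2 * n + 1)\<^sup>2"
    proof -
      have "nat (int n - - int n + 1) = 2 * n + 1" by simp
      then have "card I = (2 * n + 1)\<^sup>2"
        by (simp only: I_def card_cartesian_product card_atLeastAtMost_int power2_eq_square)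
      then show ?thesis by simp
    qed
    finally show "finite (\<Lambda> \<inter> cball 0 n) \<and> card (\<Lambda> \<inter> cball 0 n) \<le> N * (2 * n + 1)\<^sup>2"
      using finite_subset[OF cover finU] by blast
  qed
qed

text \<open>
  The bad events are collected over the annuli \<open>n \<le> |l| \<le> n + 1\<close>, each with at most
  quadratically many points, so that the Borel--Cantelli lemma can be used along \<open>n\<close>.
\<close>
lemma (in prob_space) AE_eventually_not_bad:
  assumes fd: "finite_density \<Lambda>" and d: "d > 0"
    and ev: "\<And>l. l \<in> \<Lambda> \<Longrightarrow> Bad l \<in> events"
    and small: "\<And>l. l \<in> \<Lambda> \<Longrightarrow> prob (Bad l) \<le> C * exp (- d * (cmod l)\<^sup>2)"
  shows "AE w in M. \<exists>n::nat. \<forall>l\<in>\<Lambda>. real n \<le> cmod l \<longrightarrow> w \<notin> Bad l"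
proof -
  obtain N where fin: "\<And>n::nat. finite (\<Lambda> \<inter> cball 0 n)"
    and N: "\<And>n::nat. card (\<Lambda> \<inter> cball 0 n) \<le> N * (2 * n + 1)\<^sup>2"
    using finite_density_card_disk[OF fd] by blast
  define S where "S = (\<lambda>n::nat. {l \<in> \<Lambda>. real n \<le> cmod l \<and> cmod l \<le> real (Suc n)})"
  define A where "A = (\<lambda>n. \<Union>l\<in>S n. Bad l)"
  define D where "D = \<bar>C\<bar>"
  have sub: "S n \<subseteq> \<Lambda> \<inter> cball 0 (Suc n)" for n by (auto simp: S_def)
  have finS: "finite (S n)" for n using finite_subset[OF sub fin] .
  have cardS: "card (S n) \<le> N * (2 * Suc n + 1)\<^sup>2" for n
    using card_mono[OF fin sub] N order_trans by blast
  have A: "A n \<in> events" for n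
    unfolding A_def using finS ev by (intro sets.finite_UN) (auto simp: S_def)
  have PA: "prob (A n) \<le> real N * D * ((2 * real n + 3)\<^sup>2 * exp (- d * (real n)\<^sup>2))" for n
  proof -
    have "prob (A n) \<le> (\<Sum>l\<in>S n. prob (Bad l))"
      unfolding A_def using finS ev by (intro measure_UNION_le) (auto simp: S_def)
    also have "\<dots> \<le> (\<Sum>l\<in>S n. D * exp (- d * (real n)\<^sup>2))"
    proof (rule sum_mono)
      fix l assume l: "l \<in> S n"
      have "prob (Bad l) \<le> C * exp (- d * (cmod l)\<^sup>2)" using l small by (simp add: S_def)
      also have "\<dots> \<le> D * exp (- d * (cmod l)\<^sup>2)" by (intro mult_right_mono) (auto simp: D_def)
      also have "\<dots> \<le> D * exp (- d * (real n)\<^sup>2)"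
        using l d by (intro mult_left_mono) (auto simp: S_def D_def intro!: power_mono)
      finally show "prob (Bad l) \<le> D * exp (- d * (real n)\<^sup>2)" .
    qed
    also have "\<dots> = real (card (S n)) * (D * exp (- d * (real n)\<^sup>2))" by simp
    also have "\<dots> \<le> real (N * (2 * Suc n + 1)\<^sup>2) * (D * exp (- d * (real n)\<^sup>2))"
      using cardS[of n] by (intro mult_right_mono) (auto simp: D_def simp del: of_nat_mult of_nat_power)
    also have "\<dots> = real N * D * ((2 * real n + 3)\<^sup>2 * exp (- d * (real n)\<^sup>2))"
      by (simp add: algebra_simps)
    finally show ?thesis .
  qed
  have "summable (\<lambda>n. (2 * real n + 3)\<^sup>2 * exp (- d * (real n)\<^sup>2))"
  proof (rule summable_comparison_test_bigo)
    show "summable (\<lambda>n. norm (inverse (real n ^ 2)))"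
      using inverse_power_summable[of 2, where 'a = real] by simp
    show "(\<lambda>n. (2 * real n + 3)\<^sup>2 * exp (- d * (real n)\<^sup>2)) \<in> O(\<lambda>n. inverse (real n ^ 2))"
      using d by real_asymp
  qed
  then have "summable (\<lambda>n. real N * D * ((2 * real n + 3)\<^sup>2 * exp (- d * (real n)\<^sup>2)))"
    by (rule summable_mult)
  then have "summable (\<lambda>n. prob (A n))"
    by (rule summable_comparison_test'[where N = 0]) (use PA in auto)
  then have "AE w in M. eventually (\<lambda>n. w \<in> space M - A n) sequentially"
    using A by (intro borel_cantelli_AE1) (auto simp: emeasure_eq_measure)
  then show ?thesis
  proof (rule AE_mp, intro AE_I2 impI)
    fix w assume "eventually (\<lambda>n. w \<in> space M - A n) sequentially"
    then obtain n0 where n0: "\<And>n. n \<ge> n0 \<Longrightarrow> w \<notin> A n" by (auto simp: eventually_sequentially)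
    show "\<exists>n::nat. \<forall>l\<in>\<Lambda>. real n \<le> cmod l \<longrightarrow> w \<notin> Bad l"
    proof (intro exI[of _ n0] ballI impI)
      fix l assume l: "l \<in> \<Lambda>" "real n0 \<le> cmod l"
      define n where "n = nat \<lfloor>cmod l\<rfloor>"
      have "l \<in> S n" using l(1) by (simp add: S_def n_def) linarith
      moreover have "n \<ge> n0" using l(2) by (simp add: n_def le_nat_floor)
      ultimately show "w \<notin> Bad l" using n0[of n] by (auto simp: A_def)
    qed
  qed
qed

section \<open>Uniqueness of phase retrieval\<close>

lemma linear_le_exp_square:
  fixes x k :: real
  assumes k: "k > 0"
  shows "x \<le> (1 + 1 / k) * exp (k * x\<^sup>2)"
proof -
  have "1 + k * x\<^sup>2 \<le> exp (k * x\<^sup>2)" by (rule exp_ge_add_one_self)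
  moreover have "0 \<le> k * x\<^sup>2" using k by simp
  ultimately have "1 \<le> exp (k * x\<^sup>2)" and "k * x\<^sup>2 \<le> exp (k * x\<^sup>2)" by linarith+
  moreover from this(2) have "x\<^sup>2 \<le> 1 / k * exp (k * x\<^sup>2)"
    using k by (simp add: pos_le_divide_eq mult.commute)
  moreover have "x \<le> 1 + x\<^sup>2"
    using zero_le_power2[of "x - 1/2"] by (simp add: power2_eq_square algebra_simps)
  ultimately have "x \<le> exp (k * x\<^sup>2) + 1 / k * exp (k * x\<^sup>2)" by linarith
  then show ?thesis by (simp add: distrib_right)
qed

text \<open>
  The Liouville property is applied to \<open>z K(z)\<close> instead of \<open>K(z)\<close>: this product vanishes at the
  origin, so the only constant it can be is zero. The slack between \<open>2 b\<close> and \<open>\<beta>\<close> pays for the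
  factor \<open>z\<close>.
\<close>
lemma liouville_set_imp_zero:
  assumes liou: "liouville_set (fock_space \<beta>) \<Lambda>" and fd: "finite_density \<Lambda>"
    and hol: "K holomorphic_on UNIV" and b: "2 * b < \<beta>"
    and growth: "\<And>z. cmod (K z) \<le> C * exp (b * (cmod z)\<^sup>2)"
    and far: "\<And>l. l \<in> \<Lambda> \<Longrightarrow> real n \<le> cmod l \<Longrightarrow> cmod (l * K l) \<le> D"
  shows "K z = 0"
proof -
  define L where "L = (\<lambda>z. z * K z)"
  \<comment> \<open>A quarter of the gap: \<open>2 (b + \<eta>)\<close> is the midpoint of \<open>2 b\<close> and \<open>\<beta>\<close>.\<close>
  define \<eta> where "\<eta> = (\<beta> - 2 * b) / 4"
  have \<eta>: "\<eta> > 0" "2 * (b + \<eta>) < \<beta>" using b by (simp_all add: \<eta>_def field_simps)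
  have holL: "L holomorphic_on UNIV" unfolding L_def using hol by (intro holomorphic_intros)
  have "L \<in> fock_space \<beta>"
  proof (rule in_fock_space_if_growth[OF holL \<eta>(2)])
    fix z
    have "cmod (L z) \<le> ((1 + 1 / \<eta>) * exp (\<eta> * (cmod z)\<^sup>2)) * (C * exp (b * (cmod z)\<^sup>2))"
      unfolding L_def norm_mult
      using \<eta> by (intro mult_mono growth linear_le_exp_square) auto
    then show "cmod (L z) \<le> (1 + 1 / \<eta>) * C * exp ((b + \<eta>) * (cmod z)\<^sup>2)"
      by (simp add: exp_add algebra_simps)
  qed
  moreover have "bounded (L ` \<Lambda>)"
  proof -
    have "finite (\<Lambda> \<inter> cball 0 n)" using finite_density_card_disk[OF fd] by blast
    then have "bounded (L ` (\<Lambda> \<inter> cball 0 n) \<union> cball 0 D)" by (simp add: finite_imp_bounded)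
    moreover have "L ` \<Lambda> \<subseteq> L ` (\<Lambda> \<inter> cball 0 n) \<union> cball 0 D"
      using far by (force simp: L_def not_le)
    ultimately show ?thesis by (rule bounded_subset)
  qed
  ultimately have "L constant_on UNIV" using liou by (simp add: liouville_set_def)
  then have L0: "L w = 0" for w
    by (metis (no_types, lifting) L_def UNIV_I constant_on_def mult_zero_left)
  have ne: "K w = 0" if "w \<noteq> 0" for w using L0[of w] that by (simp add: L_def)
  show ?thesis
  proof (cases "z = 0")
    case True
    have "isCont K 0"
      using hol holomorphic_on_imp_continuous_on continuous_on_eq_continuous_at by blast
    then have "(K \<longlongrightarrow> K 0) (at 0)" by (simp add: isCont_def)
    moreover have "(K \<longlongrightarrow> 0) (at 0)"
      using ne by (intro tendsto_eventually) (simp add: eventually_at_filter)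
    ultimately show ?thesis using True tendsto_unique[OF at_neq_bot] by blast
  qed (rule ne)
qed

text \<open>
  This is where the exponents meet. With growth exponent \<open>5 \<alpha> / 8\<close> for the functions,
  a product of three of them has exponent \<open>15 \<alpha> / 8\<close>, below the threshold \<open>2 \<alpha>\<close> for the Fock space
  with parameter \<open>4 \<alpha>\<close>. Dividing by the degeneracy \<open>exp (- \<alpha> |l|^2 / 8)\<close> raises it to exactly \<open>2 \<alpha>\<close>,
  which is beaten by the radius \<open>exp (- \<gamma> |l|^2)\<close>.
\<close>
lemma fock_coincidence_estimate:
  assumes \<alpha>: "\<alpha> > 0" and \<gamma>: "2 * \<alpha> < \<gamma>"
    and F: "F \<in> fock_space \<alpha>" and H: "H \<in> fock_space \<alpha>"
  shows "\<exists>C\<ge>0. (\<forall>z. cmod (F z) \<le> C * exp (5 * \<alpha> / 8 * (cmod z)\<^sup>2)) \<and>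
      (\<forall>z. cmod (F z * (deriv F z * H z - F z * deriv H z)) \<le> C * exp (15 * \<alpha> / 8 * (cmod z)\<^sup>2)) \<and>
      (\<forall>l z1 z2 z3. fat_triangle l (exp (- \<gamma> * (cmod l)\<^sup>2)) (exp (- (\<alpha> / 8) * (cmod l)\<^sup>2)) z1 z2 z3 \<longrightarrow>
         (\<forall>z\<in>{z1, z2, z3}. cmod (F z) = cmod (H z)) \<longrightarrow>
         cmod (l * (F l * (deriv F l * H l - F l * deriv H l))) \<le> C \<and>
         cmod l * \<bar>(cmod (F l))\<^sup>2 - (cmod (H l))\<^sup>2\<bar> \<le> C)"
proof -
  have "\<alpha> / 2 < 5 * \<alpha> / 8" using \<alpha> by simp
  from fock_space_growth[OF F \<alpha> this] fock_space_growth[OF H \<alpha> this]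
  obtain C1 C2 where C12: "C1 \<ge> 0" "C2 \<ge> 0"
    and F1: "\<And>z. cmod (F z) \<le> C1 * exp (5 * \<alpha> / 8 * (cmod z)\<^sup>2) \<and>
            cmod (deriv F z) \<le> C1 * exp (5 * \<alpha> / 8 * (cmod z)\<^sup>2) \<and>
            (\<forall>w\<in>cball z 1. cmod (F w - F z - deriv F z * (w - z)) \<le> C1 * exp (5 * \<alpha> / 8 * (cmod z)\<^sup>2) * (cmod (w - z))\<^sup>2)"
    and H1: "\<And>z. cmod (H z) \<le> C2 * exp (5 * \<alpha> / 8 * (cmod z)\<^sup>2) \<and>
            cmod (deriv H z) \<le> C2 * exp (5 * \<alpha> / 8 * (cmod z)\<^sup>2) \<and>
            (\<forall>w\<in>cball z 1. cmod (H w - H z - deriv H z * (w - z)) \<le> C2 * exp (5 * \<alpha> / 8 * (cmod z)\<^sup>2) * (cmod (w - z))\<^sup>2)"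
    by blast
  define C where "C = C1 + C2 + 1"
  define B where "B = (\<lambda>z::complex. C * exp (5 * \<alpha> / 8 * (cmod z)\<^sup>2))"
  have C: "C \<ge> 1" using C12 by (simp add: C_def)
  have B0: "B z > 0" for z using C by (simp add: B_def)
  have le: "C1 * exp (5 * \<alpha> / 8 * (cmod z)\<^sup>2) \<le> B z" "C2 * exp (5 * \<alpha> / 8 * (cmod z)\<^sup>2) \<le> B z" for z
    unfolding B_def using C12 by (intro mult_right_mono; simp add: C_def)+
  have F: "cmod (F z) \<le> B z" "cmod (deriv F z) \<le> B z"
     "w \<in> cball z 1 \<Longrightarrow> cmod (F w - F z - deriv F z * (w - z)) \<le> B z * (cmod (w - z))\<^sup>2" for z w
    using F1[of z] le(1)[of z] mult_right_mono[OF le(1)[of z], of "(cmod (w - z))\<^sup>2"]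
    by (auto intro: order_trans)
  have H: "cmod (H z) \<le> B z" "cmod (deriv H z) \<le> B z"
     "w \<in> cball z 1 \<Longrightarrow> cmod (H w - H z - deriv H z * (w - z)) \<le> B z * (cmod (w - z))\<^sup>2" for z w
    using H1[of z] le(2)[of z] mult_right_mono[OF le(2)[of z], of "(cmod (w - z))\<^sup>2"]
    by (auto intro: order_trans)
  define W where "W = (\<lambda>z. deriv F z * H z - F z * deriv H z)"
  define k where "k = \<gamma> - 2 * \<alpha>"
  have k: "k > 0" using \<gamma> by (simp add: k_def)
  have B3: "B z ^ 3 = C ^ 3 * exp (15 * \<alpha> / 8 * (cmod z)\<^sup>2)" for z
    by (simp add: B_def power_mult_distrib exp_of_nat_mult[symmetric])
  have W: "cmod (F z * W z) \<le> 2 * B z ^ 3" for z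
  proof -
    have "cmod (W z) \<le> cmod (deriv F z) * cmod (H z) + cmod (F z) * cmod (deriv H z)"
      unfolding W_def by (rule order_trans[OF norm_triangle_ineq4]) (simp add: norm_mult)
    also have "\<dots> \<le> B z * B z + B z * B z"
      using B0[of z] by (intro add_mono mult_mono F H) auto
    finally have "cmod (F z) * cmod (W z) \<le> B z * (B z * B z + B z * B z)"
      using B0[of z] by (intro mult_mono F) auto
    then show ?thesis by (simp add: norm_mult power3_eq_cube algebra_simps)
  qed
  define C' where "C' = 156 * C ^ 3 * (1 + 1 / k)"
  have C3: "C ^ 3 \<ge> C" "C ^ 3 \<ge> C\<^sup>2"
    using power_increasing[of 1 3 C] power_increasing[of 2 3 C] C by auto
  have "C ^ 3 \<ge> 1" using C3(1) C by simp
  have C'1: "156 * C ^ 3 \<le> C'"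
    using mult_left_mono[of 1 "1 + 1 / k" "156 * C ^ 3"] k C \<open>C ^ 3 \<ge> 1\<close> by (simp add: C'_def)
  show ?thesis
  proof (intro exI[of _ C'] conjI allI impI)
    show "C' \<ge> 0" using C'1 \<open>C ^ 3 \<ge> 1\<close> by simp
    fix z
    have "B z \<le> C' * exp (5 * \<alpha> / 8 * (cmod z)\<^sup>2)"
      unfolding B_def using C'1 C3 \<open>C ^ 3 \<ge> 1\<close> by (intro mult_right_mono) auto
    then show "cmod (F z) \<le> C' * exp (5 * \<alpha> / 8 * (cmod z)\<^sup>2)" using F(1)[of z] by simp
    have "2 * C ^ 3 * exp (15 * \<alpha> / 8 * (cmod z)\<^sup>2) \<le> C' * exp (15 * \<alpha> / 8 * (cmod z)\<^sup>2)"
      using C'1 \<open>C ^ 3 \<ge> 1\<close> by (intro mult_right_mono) auto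
    then show "cmod (F z * (deriv F z * H z - F z * deriv H z)) \<le> C' * exp (15 * \<alpha> / 8 * (cmod z)\<^sup>2)"
      using W[of z] unfolding W_def B3 by linarith
  next
    fix l z1 z2 z3
    define r where "r = exp (- \<gamma> * (cmod l)\<^sup>2)"
    define \<epsilon> where "\<epsilon> = exp (- (\<alpha> / 8) * (cmod l)\<^sup>2)"
    define P where "P = deriv F l * cnj (F l) - deriv H l * cnj (H l)"
    define G where "G = (cmod (F l))\<^sup>2 - (cmod (H l))\<^sup>2"
    assume fat: "fat_triangle l (exp (- \<gamma> * (cmod l)\<^sup>2)) (exp (- (\<alpha> / 8) * (cmod l)\<^sup>2)) z1 z2 z3"
      and eq: "\<forall>z\<in>{z1, z2, z3}. cmod (F z) = cmod (H z)"
    have r: "r > 0" "r \<le> 1" and \<epsilon>: "\<epsilon> > 0" "\<epsilon> \<le> 1"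
      using \<alpha> \<gamma> by (simp_all add: r_def \<epsilon>_def)
    have P: "cmod P \<le> 48 * (B l)\<^sup>2 * r / \<epsilon>" and G: "\<bar>G\<bar> \<le> 108 * (B l)\<^sup>2 * r\<^sup>2 / \<epsilon>"
      unfolding P_def G_def
      using three_point_estimate[where B = "B l" and F = F and H = H and F' = "deriv F l" and H' = "deriv H l",
          OF r \<epsilon> _ _ _ _ _ _ _ F(1,2) F(3) H(1,2) H(3)] fat eq
      by (auto simp: fat_triangle_def r_def \<epsilon>_def)
    have r2: "r\<^sup>2 \<le> r" using r by (simp add: power2_eq_square mult_left_le)
    have G': "\<bar>G\<bar> \<le> 108 * (B l)\<^sup>2 * r / \<epsilon>"
      using G r2 \<epsilon> by (auto intro!: order_trans[OF G] divide_right_mono mult_left_mono)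
    have decay: "cmod l * exp (- k * (cmod l)\<^sup>2) \<le> 1 + 1 / k"
      using linear_le_exp_square[OF k, of "cmod l"] by (simp add: exp_minus field_simps)
    have B3r: "B l ^ 3 * r / \<epsilon> = C ^ 3 * exp (- k * (cmod l)\<^sup>2)"
      unfolding B3 r_def \<epsilon>_def k_def by (simp add: exp_diff[symmetric] exp_add[symmetric] field_simps)
    have bound: "cmod l * X \<le> C'" if "X \<le> 156 * (B l ^ 3 * r / \<epsilon>)" for X
    proof -
      have "cmod l * X \<le> cmod l * (156 * (B l ^ 3 * r / \<epsilon>))" using that by (intro mult_left_mono) auto
      also have "\<dots> = 156 * C ^ 3 * (cmod l * exp (- k * (cmod l)\<^sup>2))" unfolding B3r by simp
      also have "\<dots> \<le> C'" unfolding C'_def using decay C \<open>C ^ 3 \<ge> 1\<close> by (intro mult_left_mono) auto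
      finally show ?thesis .
    qed
    \<comment> \<open>The Wronskian in terms of the two quantities that the three points control.\<close>
    have id: "cnj (F l) * W l = H l * P - deriv H l * of_real G"
    proof -
      have G_eq: "of_real G = F l * cnj (F l) - H l * cnj (H l)"
        by (simp add: G_def complex_norm_square del: of_real_power)
      show ?thesis unfolding W_def P_def G_eq by (simp add: algebra_simps)
    qed
    have "cmod (F l * W l) = cmod (H l * P - deriv H l * of_real G)"
      unfolding id[symmetric] by (simp add: norm_mult)
    also have "\<dots> \<le> cmod (H l) * cmod P + cmod (deriv H l) * \<bar>G\<bar>"
      by (rule order_trans[OF norm_triangle_ineq4]) (simp add: norm_mult)
    also have "\<dots> \<le> B l * (48 * (B l)\<^sup>2 * r / \<epsilon>) + B l * (108 * (B l)\<^sup>2 * r / \<epsilon>)"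
      using B0[of l] by (intro add_mono mult_mono H P G') auto
    also have "\<dots> = 156 * (B l ^ 3 * r / \<epsilon>)"
      by (simp add: power2_eq_square power3_eq_cube)
    finally have "cmod (F l * W l) \<le> 156 * (B l ^ 3 * r / \<epsilon>)" .
    from bound[OF this]
    show "cmod (l * (F l * (deriv F l * H l - F l * deriv H l))) \<le> C'"
      by (simp add: norm_mult W_def)
    have "B l \<ge> 1"
      unfolding B_def using \<alpha> C mult_mono[of 1 C 1 "exp (5 * \<alpha> / 8 * (cmod l)\<^sup>2)"] by simp
    then have "(B l)\<^sup>2 \<le> B l ^ 3" by (intro power_increasing) auto
    then have "\<bar>G\<bar> \<le> 108 * B l ^ 3 * r / \<epsilon>"
      using r \<epsilon> by (intro order_trans[OF G'] divide_right_mono mult_right_mono) auto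
    also have "\<dots> = 108 * (B l ^ 3 * r / \<epsilon>)" by simp
    also have "\<dots> \<le> 156 * (B l ^ 3 * r / \<epsilon>)"
      using r \<epsilon> B0[of l] by (intro mult_right_mono divide_nonneg_nonneg mult_nonneg_nonneg zero_le_power) auto
    finally show "cmod l * \<bar>(cmod (F l))\<^sup>2 - (cmod (H l))\<^sup>2\<bar> \<le> C'"
      unfolding G_def by (rule bound)
  qed
qed

text \<open>
  Where \<open>F\<close> has no zero, the Wronskian is the numerator of \<open>- (H / F)'\<close>. The quotient is
  therefore constant on a small disk, and the identity theorem does the rest.
\<close>
lemma proportional_if_wronskian_zero:
  assumes F: "F holomorphic_on UNIV" and H: "H holomorphic_on UNIV"
    and W: "\<And>z. F z * (deriv F z * H z - F z * deriv H z) = 0"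
    and z0: "F z0 \<noteq> 0"
  shows "\<exists>c. \<forall>z. H z = c * F z"
proof -
  have "isCont F z0"
    using F holomorphic_on_imp_continuous_on continuous_on_eq_continuous_at by blast
  then obtain e where e: "e > 0" "\<And>z. dist z0 z < e \<Longrightarrow> F z \<noteq> 0"
    using continuous_at_avoid[of z0 F 0] z0 by blast
  have "((\<lambda>z. H z / F z) has_field_derivative 0) (at z within ball z0 e)" if z: "z \<in> ball z0 e" for z
  proof -
    have nz: "F z \<noteq> 0" using z e by simp
    then have "deriv H z * F z - H z * deriv F z = 0" using W[of z] by (simp add: algebra_simps)
    moreover have "((\<lambda>z. H z / F z) has_field_derivative
        (deriv H z * F z - H z * deriv F z) / (F z * F z)) (at z within ball z0 e)"
      by (intro DERIV_divide nz has_field_derivative_at_within[OF holomorphic_derivI[OF H open_UNIV]]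
          has_field_derivative_at_within[OF holomorphic_derivI[OF F open_UNIV]]) auto
    ultimately show ?thesis by simp
  qed
  then obtain c where c: "\<And>z. z \<in> ball z0 e \<Longrightarrow> H z / F z = c"
    using has_field_derivative_zero_constant[of "ball z0 e" "\<lambda>z. H z / F z"] by auto
  have "H z = c * F z" for z
  proof (rule analytic_continuation_open[of "ball z0 e" UNIV H "\<lambda>z. c * F z"])
    show "H z = c * F z" if "z \<in> ball z0 e" for z
      using c[OF that] e(2)[of z] that by (simp add: field_simps)
  qed (use e F H in \<open>auto intro!: holomorphic_intros\<close>)
  then show ?thesis by blast
qed

text \<open>
  The deterministic half of the theorem: whichever points are drawn, fat triangles around all
  far points of \<open>\<Lambda>\<close> suffice.
\<close>
lemma uniqueness_set_if_eventually_fat: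
  fixes z :: "complex \<times> nat \<Rightarrow> complex"
  assumes \<alpha>: "\<alpha> > 0" and \<gamma>: "2 * \<alpha> < \<gamma>"
    and liou: "liouville_set (fock_space (4 * \<alpha>)) \<Lambda>" and fd: "finite_density \<Lambda>"
    and fat: "\<And>l. l \<in> \<Lambda> \<Longrightarrow> real n \<le> cmod l \<Longrightarrow>
        fat_triangle l (exp (- \<gamma> * (cmod l)\<^sup>2)) (exp (- (\<alpha> / 8) * (cmod l)\<^sup>2)) (z (l, 1)) (z (l, 2)) (z (l, 3))"
  shows "phase_retrieval_uniqueness_set (fock_space \<alpha>) {z (l, i) | l i. l \<in> \<Lambda> \<and> i \<in> {1, 2, 3}}"
proof -
  define U where "U = {z (l, i) | l i. l \<in> \<Lambda> \<and> i \<in> {1, 2, 3}}"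
  have U: "z (l, 1) \<in> U" "z (l, 2) \<in> U" "z (l, 3) \<in> U" if "l \<in> \<Lambda>" for l
    using that unfolding U_def by blast+
  have vanish: "F w = 0" if F: "F \<in> fock_space \<alpha>" and FU: "\<forall>u\<in>U. F u = 0" for F w
  proof -
    \<comment> \<open>With \<open>H = 0\<close> the bound on \<open>|F|^2 - |H|^2\<close> becomes one on \<open>|F|^2\<close>.\<close>
    have "(\<lambda>_. 0) \<in> fock_space \<alpha>" by (simp add: fock_space_def)
    from fock_coincidence_estimate[OF \<alpha> \<gamma> F this] obtain C where C: "C \<ge> 0"
      and growth: "\<And>z. cmod (F z) \<le> C * exp (5 * \<alpha> / 8 * (cmod z)\<^sup>2)"
      and est: "\<And>l z1 z2 z3. fat_triangle l (exp (- \<gamma> * (cmod l)\<^sup>2)) (exp (- (\<alpha> / 8) * (cmod l)\<^sup>2)) z1 z2 z3 \<Longrightarrow>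
         (\<forall>z\<in>{z1, z2, z3}. cmod (F z) = 0) \<Longrightarrow> cmod l * \<bar>(cmod (F l))\<^sup>2\<bar> \<le> C"
      by fastforce
    have "(F w)\<^sup>2 = 0"
    proof (rule liouville_set_imp_zero[OF liou fd, where K = "\<lambda>z. (F z)\<^sup>2"])
      show "(\<lambda>z. (F z)\<^sup>2) holomorphic_on UNIV"
        using F by (auto simp: fock_space_def intro!: holomorphic_intros)
      show "2 * (5 * \<alpha> / 4) < 4 * \<alpha>" using \<alpha> by simp
      show "cmod ((F z)\<^sup>2) \<le> C\<^sup>2 * exp (5 * \<alpha> / 4 * (cmod z)\<^sup>2)" for z
        using power_mono[OF growth[of z], of 2]
        by (simp add: norm_power power_mult_distrib exp_double[symmetric] mult.assoc)
      show "cmod (l * (F l)\<^sup>2) \<le> C" if "l \<in> \<Lambda>" "real n \<le> cmod l" for l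
        using est[OF fat[OF that]] U[OF that(1)] FU by (simp add: norm_mult norm_power)
    qed
    then show ?thesis by simp
  qed
  have "\<exists>\<tau>. cmod \<tau> = 1 \<and> H = (\<lambda>z. \<tau> * F z)"
    if F: "F \<in> fock_space \<alpha>" and H: "H \<in> fock_space \<alpha>" and eq: "\<forall>u\<in>U. cmod (F u) = cmod (H u)" for F H
  proof (cases "\<forall>w. F w = 0")
    case True
    then have "H w = 0" for w using vanish[OF H] eq by auto
    with True have "H = (\<lambda>z. 1 * F z)" by auto
    then show ?thesis by (metis norm_one)
  next
    case False
    then obtain z0 where z0: "F z0 \<noteq> 0" by blast
    have holF: "F holomorphic_on UNIV" and holH: "H holomorphic_on UNIV"
      using F H by (auto simp: fock_space_def)
    define K where "K = (\<lambda>z. F z * (deriv F z * H z - F z * deriv H z))"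
    from fock_coincidence_estimate[OF \<alpha> \<gamma> F H] obtain C where
      growth: "\<And>z. cmod (K z) \<le> C * exp (15 * \<alpha> / 8 * (cmod z)\<^sup>2)"
      and est: "\<And>l z1 z2 z3. fat_triangle l (exp (- \<gamma> * (cmod l)\<^sup>2)) (exp (- (\<alpha> / 8) * (cmod l)\<^sup>2)) z1 z2 z3 \<Longrightarrow>
         (\<forall>z\<in>{z1, z2, z3}. cmod (F z) = cmod (H z)) \<Longrightarrow> cmod (l * K l) \<le> C"
      unfolding K_def by metis
    have "K w = 0" for w
    proof (rule liouville_set_imp_zero[OF liou fd _ _ growth])
      show "K holomorphic_on UNIV"
        unfolding K_def using holF holH by (intro holomorphic_intros holomorphic_deriv) auto
      show "2 * (15 * \<alpha> / 8) < 4 * \<alpha>" using \<alpha> by simp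
      show "cmod (l * K l) \<le> C" if "l \<in> \<Lambda>" "real n \<le> cmod l" for l
        using est[OF fat[OF that]] U[OF that(1)] eq by simp
    qed
    then obtain c where c: "\<And>w. H w = c * F w"
      using proportional_if_wronskian_zero[OF holF holH _ z0] unfolding K_def by blast
    obtain u where u: "u \<in> U" "F u \<noteq> 0" using vanish[OF F] z0 by blast
    then have "cmod (F u) = cmod c * cmod (F u)" using eq c by (metis norm_mult)
    then have "cmod c = 1" using u by simp
    then show ?thesis using c by blast
  qed
  then show ?thesis unfolding phase_retrieval_uniqueness_set_def U_def by blast
qed

theorem theorem2p8:
  fixes \<alpha> \<gamma> :: real
    and f :: "complex \<Rightarrow> real"
    and \<Lambda> :: "complex set"
    and M :: "'\<omega> measure"
    and Z :: "complex \<times> nat \<Rightarrow> '\<omega> \<Rightarrow> complex"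
  assumes "\<alpha> > 0"
    and "\<gamma> > 2 * \<alpha>"
    and "\<And>z. f z = exp (- \<gamma> * (cmod z)\<^sup>2)"
    and "liouville_set (fock_space (4 * \<alpha>)) \<Lambda>"
    and "finite_density \<Lambda>"
    and "prob_space M"
    and "prob_space.indep_vars M (\<lambda>_. borel) Z (\<Lambda> \<times> {1, 2, 3})"
    and "\<And>l i. l \<in> \<Lambda> \<Longrightarrow> i \<in> {1, 2, 3} \<Longrightarrow>
           distr M borel (Z (l, i)) = uniform_measure lborel (cball l (f l))"
  shows "AE w in M. phase_retrieval_uniqueness_set (fock_space \<alpha>)
           {Z (l, i) w | l i. l \<in> \<Lambda> \<and> i \<in> {1, 2, 3}}"
proof -
  interpret prob_space M by fact
  note \<alpha> = assms(1) and \<gamma> = assms(2) and f = assms(3) and ind = assms(7) and unif = assms(8)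
  \<comment> \<open>The square root of the degeneracy threshold \<open>exp (- \<alpha> |l|^2 / 8)\<close>.\<close>
  define \<rho> where "\<rho> = (\<lambda>l::complex. exp (- (\<alpha> / 16) * (cmod l)\<^sup>2))"
  have \<rho>2: "(\<rho> l)\<^sup>2 = exp (- (\<alpha> / 8) * (cmod l)\<^sup>2)" for l
    by (simp add: \<rho>_def exp_double[symmetric])
  define Bad where "Bad = (\<lambda>l. {w \<in> space M. \<not> fat_triangle l (f l) ((\<rho> l)\<^sup>2) (Z (l, 1) w) (Z (l, 2) w) (Z (l, 3) w)})"
  have "AE w in M. \<exists>n::nat. \<forall>l\<in>\<Lambda>. real n \<le> cmod l \<longrightarrow> w \<notin> Bad l"
  proof (rule AE_eventually_not_bad)
    fix l assume l: "l \<in> \<Lambda>"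
    have "Z (l, i) \<in> borel_measurable M" if "i \<in> {1, 2, 3}" for i
      using ind l that by (auto simp: indep_vars_def)
    then have [measurable]: "Z (l, 1) \<in> borel_measurable M" "Z (l, 2) \<in> borel_measurable M" "Z (l, 3) \<in> borel_measurable M"
      by auto
    show "Bad l \<in> events" unfolding Bad_def by measurable
    show "prob (Bad l) \<le> 3 * exp (- (\<alpha> / 16) * (cmod l)\<^sup>2)"
      unfolding Bad_def \<rho>_def[symmetric]
    proof (rule order_trans[OF prob_thin_triangle_le[OF ind]])
      show "3 * \<rho> l \<le> 3 * exp (- (\<alpha> / 16) * (cmod l)\<^sup>2)" by (simp add: \<rho>_def)
    qed (use l unif[OF l] \<alpha> in \<open>auto simp: \<rho>_def f\<close>)
  qed (use assms in auto)
  then show ?thesis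
  proof (rule AE_mp, intro AE_I2 impI)
    fix w assume w: "w \<in> space M" and "\<exists>n::nat. \<forall>l\<in>\<Lambda>. real n \<le> cmod l \<longrightarrow> w \<notin> Bad l"
    then obtain n :: nat where n: "\<And>l. l \<in> \<Lambda> \<Longrightarrow> real n \<le> cmod l \<Longrightarrow> w \<notin> Bad l" by blast
    show "phase_retrieval_uniqueness_set (fock_space \<alpha>) {Z (l, i) w | l i. l \<in> \<Lambda> \<and> i \<in> {1, 2, 3}}"
    proof (rule uniqueness_set_if_eventually_fat[OF \<alpha> \<gamma> assms(4,5)])
      fix l assume "l \<in> \<Lambda>" "real n \<le> cmod l"
      from n[OF this] w show "fat_triangle l (exp (- \<gamma> * (cmod l)\<^sup>2)) (exp (- (\<alpha> / 8) * (cmod l)\<^sup>2))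
          (Z (l, 1) w) (Z (l, 2) w) (Z (l, 3) w)"
        by (simp add: Bad_def f \<rho>2)
    qed
  qed
qed

end
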